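(* Let $m\geq 5$ and $2\leq k\leq m-3$ be integers, put $n=m-2$, and let $w=(w_1,\ldots,w_k)$ be a $k$-tuple of pairwise distinct $n$-th roots of unity in $\mathbb{C}$. Then the set of points $Z_m^k(w)\subset\mathbb{P}^2=\mathbb{P}^2_{\mathbb{C}}$ dual to the line arrangement $$\mathcal{M}_m^k(w): xyz(x^n-y^n)(x^n-z^n)\prod_{j=1}^{k}(z-w_jy)=0$$ admits unexpected curves of minimal degree $m$ (that is, $m$ is the smallest degree in which $Z_m^k(w)$ admits unexpected curves), and all of these unexpected curves of degree $m$ are irreducible.
   Context: Work over $\mathbb{C}$. Unexpected curves: a finite set $Z\subset\mathbb{P}^2$ admits unexpected curves of degree $j\geq 2$ if, for a generic point $q\in\mathbb{P}^2$ (i.e. for $q$ in a nonempty Zariski open subset), $$h^0(\mathbb{P}^2,\mathcal{O}_{\mathbb{P}^2}(j)\otimes\mathcal{I}(Z+(j-1)q))>\max\left(0,\ h^0(\mathbb{P}^2,\mathcal{O}_{\mathbb{P}^2}(j)\otimes\mathcal{I}(Z))-\binom{j}{2}\right),$$ where $\mathcal{I}(Z)$ is the ideal sheaf of functions vanishing on $Z$ and $\mathcal{I}(Z+(j-1)q)$ is the ideal sheaf of functions vanishing on $Z$ and vanishing to order $j-1$ at $q$. An unexpected curve of degree $j$ (for generic $q$) is then a curve $C_q$ of degree $j$ passing through all points of $Z$ and having multiplicity at least $j-1$ at $q$; irreducibility is asserted for generic $q$. Duality: a point $(a:b:c)\in\mathbb{P}^2$ is dual to the line $ax+by+cz=0$;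 the set dual to a line arrangement is the set of points dual to its lines. *)

theory Defs
  imports "HOL-Analysis.Analysis" "HOL-Computational_Algebra.Polynomial_Factorial"
begin

section \<open>Polynomials in three variables over the complex numbers\<close>

text \<open>The ring C[x,y,z] is represented as C[x][y][z]: the innermost variable is x, the outermost
  one is z, so \<open>coeff (coeff (coeff F c) b) a\<close> is the coefficient of x^a y^b z^c.\<close>

type_synonym cpoly3 = "complex poly poly poly"

definition X :: cpoly3 where "X = [:[:[:0, 1:]:]:]"
definition Y :: cpoly3 where "Y = [:[:0, 1:]:]"
definition Z :: cpoly3 where "Z = [:0, 1:]"

definition const3 :: "complex \<Rightarrow> cpoly3" where "const3 c = [:[:[:c:]:]:]"

definition eval3 :: "cpoly3 \<Rightarrow> complex ^ 3 \<Rightarrow> complex" where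
  "eval3 F v = poly (poly (poly F [:[:v $ 3:]:]) [:v $ 2:]) (v $ 1)"

definition homogeneous :: "nat \<Rightarrow> cpoly3 \<Rightarrow> bool" where
  "homogeneous d F \<longleftrightarrow>
     (\<forall>a b c. coeff (coeff (coeff F c) b) a \<noteq> 0 \<longrightarrow> a + b + c = d)"

definition deriv_X :: "cpoly3 \<Rightarrow> cpoly3" where "deriv_X = map_poly (map_poly pderiv)"
definition deriv_Y :: "cpoly3 \<Rightarrow> cpoly3" where "deriv_Y = map_poly pderiv"
definition deriv_Z :: "cpoly3 \<Rightarrow> cpoly3" where "deriv_Z = pderiv"

definition scale3 :: "complex \<Rightarrow> cpoly3 \<Rightarrow> cpoly3" where "scale3 c F = const3 c * F"

lemma const3_add: "const3 (a + b) = const3 a + const3 b"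
  and const3_mult: "const3 (a * b) = const3 a * const3 b"
  and const3_1: "const3 1 = 1"
  by (simp_all add: const3_def one_pCons)

global_interpretation cpoly3: vector_space scale3
  by unfold_locales (simp_all add: scale3_def const3_add const3_mult const3_1 algebra_simps)

section \<open>The projective plane\<close>

text \<open>A point is the set of all its (nonzero) homogeneous coordinate vectors.\<close>

typedef proj2 = "{L :: (complex ^ 3) set. \<exists>v. v \<noteq> 0 \<and> L = {c *s v | c. c \<noteq> 0}}"
  morphisms coords Abs_proj2
proof -
  have "(axis 1 1 :: complex ^ 3) \<noteq> 0" by (simp add: axis_eq_0_iff)
  then show ?thesis by blast
qed

definition zero_locus :: "cpoly3 \<Rightarrow> proj2 set" where
  "zero_locus F = {p. \<forall>v\<in>coords p. eval3 F v = 0}"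

definition zariski_closed :: "proj2 set \<Rightarrow> bool" where
  "zariski_closed S \<longleftrightarrow>
     (\<exists>\<F>. (\<forall>F\<in>\<F>. \<exists>d. homogeneous d F) \<and> S = (\<Inter>F\<in>\<F>. zero_locus F))"

definition zariski_open :: "proj2 set \<Rightarrow> bool" where
  "zariski_open U \<longleftrightarrow> zariski_closed (- U)"

definition generically :: "(proj2 \<Rightarrow> bool) \<Rightarrow> bool" where
  "generically P \<longleftrightarrow> (\<exists>U. zariski_open U \<and> U \<noteq> {} \<and> (\<forall>q\<in>U. P q))"

text \<open>The line ax + by + cz = 0 dual to the point (a : b : c).\<close>

definition dual_line :: "proj2 \<Rightarrow> proj2 set" where
  "dual_line p =
     {q. \<forall>u\<in>coords p. \<forall>v\<in>coords q. u $ 1 * v $ 1 + u $ 2 * v $ 2 + u $ 3 * v $ 3 = 0}"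

text \<open>The lines of the arrangement F = 0 are the lines contained in the zero locus of F.\<close>

definition arrangement_lines :: "cpoly3 \<Rightarrow> proj2 set set" where
  "arrangement_lines F = {L \<in> range dual_line. L \<subseteq> zero_locus F}"

definition dual_points :: "cpoly3 \<Rightarrow> proj2 set" where
  "dual_points F = {p. dual_line p \<in> arrangement_lines F}"

section \<open>Unexpected curves\<close>

text \<open>Vanishing to order at least r: all partial derivatives of order less than r vanish. For a
  form this agrees with the order of vanishing of its dehomogenization in any affine chart
  around the point.\<close>

definition vanishes_to_order :: "nat \<Rightarrow> cpoly3 \<Rightarrow> proj2 \<Rightarrow> bool" where
  "vanishes_to_order r F q \<longleftrightarrow>
     (\<forall>a b c. a + b + c < r \<longrightarrow>
        (\<forall>v\<in>coords q. eval3 ((deriv_X ^^ a) ((deriv_Y ^^ b) ((deriv_Z ^^ c) F))) v = 0))"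

text \<open>The global sections of O(j) twisted by the ideal sheaf I(S), respectively I(S + rq), are the
  forms of degree j (including 0) that vanish on S, respectively vanish on S and vanish to
  order r at q.\<close>

definition sections :: "nat \<Rightarrow> proj2 set \<Rightarrow> cpoly3 set" where
  "sections j S = {F. homogeneous j F \<and> S \<subseteq> zero_locus F}"

definition sections_fat :: "nat \<Rightarrow> proj2 set \<Rightarrow> nat \<Rightarrow> proj2 \<Rightarrow> cpoly3 set" where
  "sections_fat j S r q = {F \<in> sections j S. vanishes_to_order r F q}"

definition h0 :: "cpoly3 set \<Rightarrow> nat" where "h0 V = cpoly3.dim V"

definition admits_unexpected_curves :: "proj2 set \<Rightarrow> nat \<Rightarrow> bool" where
  "admits_unexpected_curves S j \<longleftrightarrow>
     finite S \<and> j \<ge> 2 \<and>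
     generically (\<lambda>q. int (h0 (sections_fat j S (j - 1) q))
                        > max 0 (int (h0 (sections j S)) - int (j choose 2)))"

text \<open>F is an equation of a curve \<open>C\<^sub>q\<close> of degree j passing through S with multiplicity at least
  j - 1 at q. A curve is given by its equation, so it is irreducible iff F is an irreducible
  element of the polynomial ring.\<close>

definition unexpected_curve :: "proj2 set \<Rightarrow> nat \<Rightarrow> proj2 \<Rightarrow> cpoly3 \<Rightarrow> bool" where
  "unexpected_curve S j q F \<longleftrightarrow> F \<noteq> 0 \<and> F \<in> sections_fat j S (j - 1) q"

section \<open>The arrangements\<close>

definition arrangement_poly :: "nat \<Rightarrow> nat \<Rightarrow> (nat \<Rightarrow> complex) \<Rightarrow> cpoly3" where
  "arrangement_poly m k w =
     (let n = m - 2 in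
      X * Y * Z * (X ^ n - Y ^ n) * (X ^ n - Z ^ n) * (\<Prod>j = 1..k. Z - const3 (w j) * Y))"

definition Z_points :: "nat \<Rightarrow> nat \<Rightarrow> (nat \<Rightarrow> complex) \<Rightarrow> proj2 set" where
  "Z_points m k w = dual_points (arrangement_poly m k w)"

end

theory Submission
  imports Defs "HOL-Computational_Algebra.Fundamental_Theorem_Algebra"
begin

text \<open>Let \<open>Q = (p : q : 1)\<close> be a general point. A form \<open>F\<close> of degree \<open>d\<close> with multiplicity at least
  \<open>d - 1\<close> at \<open>Q\<close> can be written \<open>F(x, y, z) = A(x - pz, y - qz) + z B(x - pz, y - qz)\<close> with binary forms
  \<open>A\<close> and \<open>B\<close> of degrees \<open>d\<close> and \<open>d - 1\<close>. The \<open>m\<close> points of the set on the line \<open>z = 0\<close> are zeros of \<open>A\<close>;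
  once \<open>A = 0\<close>, the \<open>m - 1\<close> points of the line \<open>y = 0\<close> outside \<open>z = 0\<close> and one more point of the line
  \<open>x = 0\<close> give \<open>m\<close> distinct zeros of \<open>B\<close>. Hence \<open>F = 0\<close> if \<open>d < m\<close>, and for \<open>d = m\<close> the form \<open>A\<close>, and with it
  \<open>F\<close>, is unique up to a scalar. A curve of degree \<open>m\<close> is provided by the derivation
  \<open>x\<^bsup>n+1\<^esup> \<partial>\<^sub>x + y\<^bsup>n+1\<^esup> \<partial>\<^sub>y + z\<^bsup>n+1\<^esup> \<partial>\<^sub>z\<close>, which is tangent to all lines of the arrangement. For this curve
  \<open>A\<close> and \<open>B\<close> have no common zero, and a polynomial that is linear in one variable with coprime
  coefficients is irreducible. Finally, counting on the coordinate triangle shows that forms of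
  degree \<open>m\<close> through the set have dimension at most \<open>m choose 2\<close>, so that no such curve is expected.\<close>

section \<open>Ternary polynomials\<close>

lemma const3_0 [simp]: "const3 0 = 0"
  by (simp add: const3_def)

lemma const3_eq_0_iff [simp]: "const3 k = 0 \<longleftrightarrow> k = 0"
  by (simp add: const3_def)

text \<open>Constants, sums and multiplication by a variable generate the ring. Identities between
  substitutions and derivations are thereby reduced to these generators.\<close>

lemma cpoly3_induct [case_names const add X Y Z]:
  assumes const: "\<And>k. P (const3 k)"
    and add: "\<And>F G. P F \<Longrightarrow> P G \<Longrightarrow> P (F + G)"
    and X: "\<And>F. P F \<Longrightarrow> P (X * F)"
    and Y: "\<And>F. P F \<Longrightarrow> P (Y * F)"
    and Z: "\<And>F. P F \<Longrightarrow> P (Z * F)"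
  shows "P F"
proof -
  have 1: "P [:[:p:]:]" for p
  proof (induction p)
    case 0
    then show ?case using const[of 0] by simp
  next
    case (pCons a p)
    have "[:[:pCons a p:]:] = const3 a + X * [:[:p:]:]"
      by (simp add: const3_def X_def)
    then show ?case using const add X pCons by metis
  qed
  have 2: "P [:g:]" for g
  proof (induction g)
    case 0
    then show ?case using const[of 0] by simp
  next
    case (pCons a p)
    have "[:pCons a p:] = [:[:a:]:] + Y * [:p:]"
      by (simp add: Y_def)
    then show ?case using 1 add Y pCons by metis
  qed
  show ?thesis
  proof (induction F)
    case 0
    then show ?case using const[of 0] by simp
  next
    case (pCons a p)
    have "pCons a p = [:a:] + Z * p"
      by (simp add: Z_def)
    then show ?case using 2 add Z pCons by metis
  qed
qed

abbreviation coeff3 :: "nat \<Rightarrow> nat \<Rightarrow> nat \<Rightarrow> cpoly3 \<Rightarrow> complex" where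
  "coeff3 a b c F \<equiv> coeff (coeff (coeff F c) b) a"

lemma coeff3_const: "coeff3 a b c (const3 k) = (if a = 0 \<and> b = 0 \<and> c = 0 then k else 0)"
  by (auto simp: const3_def coeff_pCons split: nat.splits)

lemma coeff3_const_mult: "coeff3 a b c (const3 k * F) = k * coeff3 a b c F"
  by (simp add: const3_def)

lemma coeff3_X_mult: "coeff3 a b c (X * F) = (if a = 0 then 0 else coeff3 (a - 1) b c F)"
  by (auto simp: X_def coeff_pCons split: nat.splits)

lemma coeff3_Y_mult: "coeff3 a b c (Y * F) = (if b = 0 then 0 else coeff3 a (b - 1) c F)"
  by (auto simp: Y_def coeff_pCons split: nat.splits)

lemma coeff3_Z_mult: "coeff3 a b c (Z * F) = (if c = 0 then 0 else coeff3 a b (c - 1) F)"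
  by (auto simp: Z_def coeff_pCons split: nat.splits)

lemma cpoly3_eqI: "(\<And>a b c. coeff3 a b c F = coeff3 a b c G) \<Longrightarrow> F = G"
  by (simp add: poly_eq_iff)

subsection \<open>Evaluation\<close>

lemma eval3_0 [simp]: "eval3 0 v = 0"
  and eval3_1 [simp]: "eval3 1 v = 1"
  and eval3_add [simp]: "eval3 (F + G) v = eval3 F v + eval3 G v"
  and eval3_diff [simp]: "eval3 (F - G) v = eval3 F v - eval3 G v"
  and eval3_mult [simp]: "eval3 (F * G) v = eval3 F v * eval3 G v"
  and eval3_power [simp]: "eval3 (F ^ e) v = eval3 F v ^ e"
  and eval3_X [simp]: "eval3 X v = v $ 1"
  and eval3_Y [simp]: "eval3 Y v = v $ 2"
  and eval3_Z [simp]: "eval3 Z v = v $ 3"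
  and eval3_const [simp]: "eval3 (const3 k) v = k"
  by (simp_all add: eval3_def X_def Y_def Z_def const3_def poly_power)

lemma eval3_prod [simp]: "eval3 (prod f A) v = (\<Prod>i\<in>A. eval3 (f i) v)"
  by (induction A rule: infinite_finite_induct) simp_all

text \<open>The constants already form an infinite subset of the coefficient domain, whereas a
  nonzero polynomial has finitely many roots there.\<close>

lemma poly_eq_0_if_zero_at_constants:
  fixes p :: "'a::{idom, ring_char_0} poly poly"
  assumes "\<And>k. poly p [:k:] = 0"
  shows "p = 0"
proof (rule ccontr)
  assume "p \<noteq> 0"
  then have "finite {x. poly p x = 0}"
    by (rule poly_roots_finite)
  moreover have "range (\<lambda>k. [:k:]) \<subseteq> {x. poly p x = 0}"
    using assms by auto
  moreover have "infinite (range (\<lambda>k::'a. [:k:]))"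
    by (subst finite_image_iff) (auto intro: injI simp: infinite_UNIV_char_0)
  ultimately show False
    using finite_subset by blast
qed

text \<open>The infinite-roots argument is applied to x, then y, then z, from the innermost variable
  outwards.\<close>

lemma eval3_eq_0:
  assumes "\<And>v. eval3 F v = 0"
  shows "F = 0"
proof -
  have "poly (poly (poly F [:[:z:]:]) [:y:]) x = 0" for x y z
    using assms[of "vector [x, y, z]"] by (simp add: eval3_def)
  then have "poly (poly F [:[:z:]:]) [:y:] = 0" for y z
    by (simp add: poly_all_0_iff_0[symmetric])
  then have *: "poly F [:[:z:]:] = 0" for z
    by (intro poly_eq_0_if_zero_at_constants) auto
  show ?thesis
  proof (rule ccontr)
    assume "F \<noteq> 0"
    then have "finite {x. poly F x = 0}"
      by (rule poly_roots_finite)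
    moreover have "range (\<lambda>k. [:[:k:]:]) \<subseteq> {x. poly F x = 0}"
      using * by auto
    moreover have "infinite (range (\<lambda>k::complex. [:[:k:]:]))"
      by (subst finite_image_iff) (auto intro: injI simp: infinite_UNIV_char_0)
    ultimately show False
      using finite_subset by blast
  qed
qed

subsection \<open>Substitution\<close>

text \<open>This is the endomorphism of C[x,y,z] that fixes the constants and sends
  \<open>X\<close>, \<open>Y\<close>, \<open>Z\<close> to \<open>A\<close>, \<open>B\<close>,
  \<open>C\<close>. The three nested evaluations follow the nesting of the coefficient
  rings.\<close>

definition subst3 :: "cpoly3 \<Rightarrow> cpoly3 \<Rightarrow> cpoly3 \<Rightarrow> cpoly3 \<Rightarrow> cpoly3" where
  "subst3 A B C F =
     poly (map_poly (\<lambda>g. poly (map_poly (\<lambda>p. poly (map_poly const3 p) A) g) B) F) C"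

lemma poly_map_poly_hom:
  fixes h :: "'a::comm_ring_1 \<Rightarrow> 'b::comm_ring_1"
  assumes [simp]: "h 0 = 0"
    and add: "\<And>x y. h (x + y) = h x + h y"
    and mult: "\<And>x y. h (x * y) = h x * h y"
  shows "poly (map_poly h (p + q)) s = poly (map_poly h p) s + poly (map_poly h q) s"
    and "poly (map_poly h (p * q)) s = poly (map_poly h p) s * poly (map_poly h q) s"
proof -
  have a: "map_poly h (p + q) = map_poly h p + map_poly h q" for p q
    by (rule poly_eqI) (simp add: coeff_map_poly add)
  show "poly (map_poly h (p + q)) s = poly (map_poly h p) s + poly (map_poly h q) s"
    by (simp add: a)
  have m: "map_poly h (smult k q) = smult (h k) (map_poly h q)" for k
    by (rule poly_eqI) (simp add: coeff_map_poly mult)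
  show "poly (map_poly h (p * q)) s = poly (map_poly h p) s * poly (map_poly h q) s"
    by (induction p) (simp_all add: map_poly_pCons a m algebra_simps)
qed

lemma
  shows subst3_add: "subst3 A B C (F + G) = subst3 A B C F + subst3 A B C G"
    and subst3_mult: "subst3 A B C (F * G) = subst3 A B C F * subst3 A B C G"
proof -
  let ?h = "\<lambda>p. poly (map_poly const3 p) A"
  let ?k = "\<lambda>g. poly (map_poly ?h g) B"
  have h: "?h 0 = 0" "?h (p + q) = ?h p + ?h q" "?h (p * q) = ?h p * ?h q" for p q
    by (simp_all add: poly_map_poly_hom const3_add const3_mult)
  have k: "?k 0 = 0" "?k (p + q) = ?k p + ?k q" "?k (p * q) = ?k p * ?k q" for p q
    by (simp_all add: poly_map_poly_hom[of ?h, OF h])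
  show "subst3 A B C (F + G) = subst3 A B C F + subst3 A B C G"
    "subst3 A B C (F * G) = subst3 A B C F * subst3 A B C G"
    unfolding subst3_def by (simp_all add: poly_map_poly_hom[of ?k, OF k])
qed

lemma subst3_const: "subst3 A B C (const3 k) = const3 k"
  and subst3_X: "subst3 A B C X = A"
  and subst3_Y: "subst3 A B C Y = B"
  and subst3_Z: "subst3 A B C Z = C"
  by (simp_all add: subst3_def X_def Y_def Z_def const3_def[of k] map_poly_pCons const3_1)

lemmas subst3_simps = subst3_add subst3_mult subst3_const subst3_X subst3_Y subst3_Z

lemma eval3_subst3:
  "eval3 (subst3 A B C F) v = eval3 F (vector [eval3 A v, eval3 B v, eval3 C v])"
  by (induction F rule: cpoly3_induct) (simp_all add: subst3_simps)

subsection \<open>Homogeneous polynomials\<close>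

lemma poly_eq_sum_upto:
  fixes p :: "'a::comm_semiring_1 poly"
  assumes "\<And>i. i > N \<Longrightarrow> coeff p i = 0"
  shows "poly p x = (\<Sum>i\<le>N. coeff p i * x ^ i)"
proof -
  have "degree p \<le> N"
    using assms by (meson degree_le)
  then show ?thesis
    unfolding poly_altdef by (intro sum.mono_neutral_left) (auto simp: coeff_eq_0)
qed

lemma homogeneous_coeff3: "homogeneous d F \<Longrightarrow> a + b + c \<noteq> d \<Longrightarrow> coeff3 a b c F = 0"
  by (auto simp: homogeneous_def)

lemma eval3_homogeneous:
  assumes "homogeneous d F"
  shows "eval3 F v = (\<Sum>c\<le>d. \<Sum>b\<le>d-c. coeff3 (d-c-b) b c F * (v$1)^(d-c-b) * (v$2)^b * (v$3)^c)"
proof -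
  have C: "coeff F c = 0" if "c > d" for c
    using that by (intro poly_eqI) (simp add: homogeneous_coeff3[OF assms])
  have B: "coeff (coeff F c) b = 0" if "b > d - c" for b c
    using that by (intro poly_eqI) (simp add: homogeneous_coeff3[OF assms])
  have A: "poly (coeff (coeff F c) b) x = coeff3 (d-c-b) b c F * x ^ (d-c-b)" if "c \<le> d" "b \<le> d-c" for b c x
  proof -
    have "coeff (coeff F c) b = monom (coeff3 (d-c-b) b c F) (d-c-b)"
      using that by (intro poly_eqI) (auto simp: coeff_monom intro!: homogeneous_coeff3[OF assms])
    then show ?thesis
      by (metis poly_monom)
  qed
  have "eval3 F v = (\<Sum>c\<le>d. \<Sum>b\<le>d-c. poly (coeff (coeff F c) b) (v$1) * (v$2)^b * (v$3)^c)"
    unfolding eval3_def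
    by (simp add: poly_eq_sum_upto[OF C] poly_sum poly_power poly_eq_sum_upto[OF B] sum_distrib_right)
  also have "\<dots> = (\<Sum>c\<le>d. \<Sum>b\<le>d-c. coeff3 (d-c-b) b c F * (v$1)^(d-c-b) * (v$2)^b * (v$3)^c)"
    by (intro sum.cong refl) (simp add: A)
  finally show ?thesis .
qed

lemma homogeneous_eval3:
  assumes "homogeneous d F"
  shows "eval3 F (k *s v) = k ^ d * eval3 F v"
  unfolding eval3_homogeneous[OF assms] sum_distrib_left
proof (intro sum.cong refl)
  fix c b assume "c \<in> {..d}" "b \<in> {..d-c}"
  then have "k ^ d = k ^ (d-c-b) * k ^ b * k ^ c"
    by (simp flip: power_add)
  then show "coeff3 (d-c-b) b c F * ((k *s v)$1)^(d-c-b) * ((k *s v)$2)^b * ((k *s v)$3)^c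
    = k ^ d * (coeff3 (d-c-b) b c F * (v$1)^(d-c-b) * (v$2)^b * (v$3)^c)"
    by (simp add: power_mult_distrib)
qed

lemma coeff3_dilation:
  "coeff3 a b c (subst3 (const3 k * X) (const3 k * Y) (const3 k * Z) F) = k ^ (a + b + c) * coeff3 a b c F"
proof (induction F arbitrary: a b c rule: cpoly3_induct)
  case (X F)
  then show ?case
    by (cases a) (simp_all add: subst3_simps coeff3_const_mult mult.assoc coeff3_X_mult)
next
  case (Y F)
  then show ?case
    by (cases b) (simp_all add: subst3_simps coeff3_const_mult mult.assoc coeff3_Y_mult)
next
  case (Z F)
  then show ?case
    by (cases c) (simp_all add: subst3_simps coeff3_const_mult mult.assoc coeff3_Z_mult)
qed (simp_all add: subst3_simps coeff3_const distrib_left)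

text \<open>For the converse the dilation by 2 suffices: it multiplies a coefficient of total degree
  e by \<open>2 ^ e\<close>, and distinct powers of 2 have distinct norms. In this form homogeneity
  of products and of substituted forms is a calculation with values.\<close>

lemma homogeneous_iff_eval3:
  "homogeneous d F \<longleftrightarrow> (\<forall>k v. eval3 F (k *s v) = k ^ d * eval3 F v)"
proof
  assume *: "\<forall>k v. eval3 F (k *s v) = k ^ d * eval3 F v"
  let ?D = "subst3 (const3 2 * X) (const3 2 * Y) (const3 2 * Z) F"
  have "vector [2 * v$1, 2 * v$2, 2 * v$3] = 2 *s v" for v :: "complex^3"
    by (simp add: vec_eq_iff forall_3)
  then have "eval3 (?D - const3 (2 ^ d) * F) v = 0" for v
    using *[rule_format, of 2 v] by (simp add: eval3_subst3)
  then have "?D = const3 (2 ^ d) * F"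
    using eval3_eq_0[of "?D - const3 (2 ^ d) * F"] by auto
  then have eq: "2 ^ (a + b + c) * coeff3 a b c F = 2 ^ d * coeff3 a b c F" for a b c
    by (metis coeff3_dilation coeff3_const_mult)
  have "a + b + c = d" if "coeff3 a b c F \<noteq> 0" for a b c
  proof -
    have "(2::complex) ^ (a + b + c) = 2 ^ d"
      using eq[of a b c] that by simp
    then have "norm ((2::complex) ^ (a + b + c)) = norm ((2::complex) ^ d)"
      by simp
    then show ?thesis
      by (simp add: norm_power)
  qed
  then show "homogeneous d F"
    by (auto simp: homogeneous_def)
qed (auto intro: homogeneous_eval3)

lemma homogeneous_mult: "homogeneous d F \<Longrightarrow> homogeneous e G \<Longrightarrow> homogeneous (d + e) (F * G)"
  unfolding homogeneous_iff_eval3 by (simp add: power_add)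

lemma homogeneous_prod:
  assumes "\<And>i. i \<in> A \<Longrightarrow> homogeneous 1 (f i)"
  shows "homogeneous (card A) (prod f A)"
proof -
  have "homogeneous 0 1"
    by (simp add: homogeneous_iff_eval3)
  then show ?thesis
    using assms homogeneous_mult[where d = 1]
    by (induction A rule: infinite_finite_induct) simp_all
qed

subsection \<open>Partial derivatives\<close>

lemma map_poly_derivation:
  fixes D :: "'a::comm_ring_1 \<Rightarrow> 'a"
  assumes [simp]: "D 0 = 0"
    and add: "\<And>x y. D (x + y) = D x + D y"
    and mult: "\<And>x y. D (x * y) = D x * y + x * D y"
  shows "map_poly D (p + q) = map_poly D p + map_poly D q"
    and "map_poly D (p * q) = map_poly D p * q + p * map_poly D q"
proof -
  show a: "map_poly D (p + q) = map_poly D p + map_poly D q" for p q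
    by (rule poly_eqI) (simp add: coeff_map_poly add)
  have m: "map_poly D (smult k q) = smult (D k) q + smult k (map_poly D q)" for k
    by (rule poly_eqI) (simp add: coeff_map_poly mult)
  show "map_poly D (p * q) = map_poly D p * q + p * map_poly D q"
    by (induction p) (simp_all add: map_poly_pCons a m algebra_simps)
qed

lemma deriv_Z_add: "deriv_Z (F + G) = deriv_Z F + deriv_Z G"
  and deriv_Z_mult: "deriv_Z (F * G) = deriv_Z F * G + F * deriv_Z G"
  and deriv_Y_add: "deriv_Y (F + G) = deriv_Y F + deriv_Y G"
  and deriv_Y_mult: "deriv_Y (F * G) = deriv_Y F * G + F * deriv_Y G"
  and deriv_X_add: "deriv_X (F + G) = deriv_X F + deriv_X G"
  and deriv_X_mult: "deriv_X (F * G) = deriv_X F * G + F * deriv_X G"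
proof -
  show "deriv_Z (F + G) = deriv_Z F + deriv_Z G" "deriv_Z (F * G) = deriv_Z F * G + F * deriv_Z G"
    by (simp_all add: deriv_Z_def pderiv_add pderiv_mult algebra_simps)
  let ?D = "pderiv :: complex poly \<Rightarrow> complex poly"
  have D: "?D 0 = 0" "?D (p + q) = ?D p + ?D q" "?D (p * q) = ?D p * q + p * ?D q" for p q
    by (simp_all add: pderiv_add pderiv_mult algebra_simps)
  let ?E = "map_poly ?D"
  have E': "?E 0 = 0" "?E (p + q) = ?E p + ?E q" "?E (p * q) = ?E p * q + p * ?E q" for p q
    using map_poly_derivation[of ?D, OF D] by simp_all
  have D2: "map_poly pderiv (p + q) = map_poly pderiv p + map_poly pderiv q"
     "map_poly pderiv (p * q) = map_poly pderiv p * q + p * map_poly pderiv q" for p q :: cpoly3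
    using map_poly_derivation[of "pderiv :: complex poly poly \<Rightarrow> _"]
    by (simp_all add: pderiv_add pderiv_mult algebra_simps)
  show "deriv_Y (F + G) = deriv_Y F + deriv_Y G" "deriv_Y (F * G) = deriv_Y F * G + F * deriv_Y G"
    by (simp_all add: deriv_Y_def D2)
  show "deriv_X (F + G) = deriv_X F + deriv_X G" "deriv_X (F * G) = deriv_X F * G + F * deriv_X G"
    unfolding deriv_X_def using map_poly_derivation[of ?E, OF E'] by simp_all
qed

lemma deriv_basics:
  "deriv_X (const3 k) = 0" "deriv_X X = 1" "deriv_X Y = 0" "deriv_X Z = 0"
  "deriv_Y (const3 k) = 0" "deriv_Y X = 0" "deriv_Y Y = 1" "deriv_Y Z = 0"
  "deriv_Z (const3 k) = 0" "deriv_Z X = 0" "deriv_Z Y = 0" "deriv_Z Z = 1"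
  by (simp_all add: deriv_X_def deriv_Y_def deriv_Z_def const3_def X_def Y_def Z_def
        map_poly_pCons pderiv_pCons one_pCons)

lemma coeff3_deriv_X: "coeff3 a b c (deriv_X F) = of_nat (a + 1) * coeff3 (a + 1) b c F"
  and coeff3_deriv_Y: "coeff3 a b c (deriv_Y F) = of_nat (b + 1) * coeff3 a (b + 1) c F"
  by (simp_all add: deriv_X_def deriv_Y_def coeff_map_poly coeff_pderiv of_nat_poly del: of_nat_Suc)

text \<open>The factor is a product of positive integers, hence nonzero in characteristic 0; only
  this matters for isolating coefficients.\<close>

lemma coeff3_deriv_X_funpow:
  "\<exists>k\<noteq>0. \<forall>F. coeff3 a b c ((deriv_X ^^ i) F) = k * coeff3 (a + i) b c F"
proof (induction i arbitrary: a)
  case (Suc i)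
  obtain k where "k \<noteq> 0" "\<And>F. coeff3 (a + 1) b c ((deriv_X ^^ i) F) = k * coeff3 (a + 1 + i) b c F"
    using Suc.IH[of "a + 1"] by blast
  then show ?case
    by (intro exI[of _ "of_nat (a + 1) * k"]) (simp add: coeff3_deriv_X del: of_nat_Suc)
qed (auto intro: exI[of _ 1])

lemma coeff3_deriv_Y_funpow:
  "\<exists>k\<noteq>0. \<forall>F. coeff3 a b c ((deriv_Y ^^ i) F) = k * coeff3 a (b + i) c F"
proof (induction i arbitrary: b)
  case (Suc i)
  obtain k where "k \<noteq> 0" "\<And>F. coeff3 a (b + 1) c ((deriv_Y ^^ i) F) = k * coeff3 a (b + 1 + i) c F"
    using Suc.IH[of "b + 1"] by blast
  then show ?case
    by (intro exI[of _ "of_nat (b + 1) * k"]) (simp add: coeff3_deriv_Y del: of_nat_Suc)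
qed (auto intro: exI[of _ 1])

section \<open>Forms with a point of large multiplicity\<close>

text \<open>The linear change of coordinates that carries (0 : 0 : 1) to (p : q : 1), acting on
  polynomials by composition.\<close>

definition shear :: "complex \<Rightarrow> complex \<Rightarrow> cpoly3 \<Rightarrow> cpoly3" where
  "shear p q = subst3 (X + const3 p * Z) (Y + const3 q * Z) Z"

lemma shear_add: "shear p q (F + G) = shear p q F + shear p q G"
  and shear_mult: "shear p q (F * G) = shear p q F * shear p q G"
  and shear_const: "shear p q (const3 k) = const3 k"
  and shear_X: "shear p q X = X + const3 p * Z"
  and shear_Y: "shear p q Y = Y + const3 q * Z"
  and shear_Z: "shear p q Z = Z"
  by (simp_all add: shear_def subst3_simps)

lemmas shear_simps = shear_add shear_mult shear_const shear_X shear_Y shear_Z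

lemma shear_1: "shear p q 1 = 1"
  using shear_const[of p q 1] by (simp add: const3_1)

lemma eval3_shear:
  "eval3 (shear p q F) v = eval3 F (vector [v $ 1 + p * v $ 3, v $ 2 + q * v $ 3, v $ 3])"
  by (simp add: shear_def eval3_subst3)

lemma shear_shear: "shear (- p) (- q) (shear p q F) = F"
proof -
  have "const3 (- k) + const3 k = 0" for k
    by (simp add: const3_def)
  then have "const3 (- k) * Z + const3 k * Z = 0" for k
    by (metis distrib_right mult_zero_left)
  then show ?thesis
    by (induction F rule: cpoly3_induct) (simp_all add: shear_simps add.assoc)
qed

lemma homogeneous_shear:
  assumes "homogeneous d F"
  shows "homogeneous d (shear p q F)"
proof -
  have "(vector [(k *s v) $ 1 + p * (k *s v) $ 3, (k *s v) $ 2 + q * (k *s v) $ 3, (k *s v) $ 3] :: complex ^ 3)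
      = k *s vector [v $ 1 + p * v $ 3, v $ 2 + q * v $ 3, v $ 3]" for k and v :: "complex ^ 3"
    by (simp add: vec_eq_iff forall_3 algebra_simps)
  then show ?thesis
    unfolding homogeneous_iff_eval3 eval3_shear by (simp add: homogeneous_eval3[OF assms])
qed

text \<open>\<open>X\<close> and \<open>Y\<close> are changed only by multiples of \<open>Z\<close>,
  which is constant for both derivations.\<close>

lemma deriv_X_shear: "deriv_X (shear p q F) = shear p q (deriv_X F)"
  and deriv_Y_shear: "deriv_Y (shear p q F) = shear p q (deriv_Y F)"
proof -
  have 0: "shear p q 0 = 0"
    using shear_const[of p q 0] by simp
  show "deriv_X (shear p q F) = shear p q (deriv_X F)"
    by (induction F rule: cpoly3_induct)
       (simp_all add: shear_simps shear_1 0 deriv_X_add deriv_X_mult deriv_basics)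
  show "deriv_Y (shear p q F) = shear p q (deriv_Y F)"
    by (induction F rule: cpoly3_induct)
       (simp_all add: shear_simps shear_1 0 deriv_Y_add deriv_Y_mult deriv_basics)
qed

lemma shear_diff: "shear p q (F - G) = shear p q F - shear p q G"
  using shear_add[of p q "F - G" G] by (simp add: algebra_simps)

lemma shear_power: "shear p q (F ^ e) = shear p q F ^ e"
  by (induction e) (simp_all add: shear_1 shear_mult)

lemma shear_unit: "F dvd 1 \<Longrightarrow> shear p q F dvd 1"
  by (metis dvd_def shear_1 shear_mult)

lemma shear_0: "shear p q 0 = 0"
  using shear_const[of p q 0] by simp

text \<open>A shear is a ring automorphism with inverse \<open>shear (- p) (- q)\<close>, so it
  preserves factorizations and units.\<close>

lemma irreducible_shear:
  assumes "irreducible (shear p q F)"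
  shows "irreducible F"
proof (rule irreducibleI)
  show "F \<noteq> 0"
    using assms by (auto simp: shear_0)
  show "\<not> F dvd 1"
    using assms shear_unit by (auto simp: irreducible_def)
  fix G H assume "F = G * H"
  then have "shear p q G dvd 1 \<or> shear p q H dvd 1"
    using assms by (simp add: irreducible_def shear_mult)
  then show "G dvd 1 \<or> H dvd 1"
    using shear_unit[of _ "- p" "- q"] shear_shear by metis
qed

lemma const3_unit: "c \<noteq> 0 \<Longrightarrow> const3 c dvd 1"
  by (intro dvdI[of _ _ "const3 (1 / c)"]) (simp flip: const3_mult add: const3_1)

lemma eval3_001: "eval3 H (vector [0, 0, 1]) = (\<Sum>c\<le>degree H. coeff3 0 0 c H)"
proof -
  have "eval3 H (vector [0, 0, 1]) = poly (poly (poly H 1) 0) 0"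
    by (simp add: eval3_def one_pCons)
  also have "\<dots> = coeff (coeff (poly H 1) 0) 0"
    by (simp add: poly_0_coeff_0)
  finally show ?thesis
    by (simp add: poly_altdef coeff_sum)
qed

text \<open>The point \<open>(p : q : 1)\<close> is moved to \<open>(0 : 0 : 1)\<close>, where a derivative of order \<open>a + b\<close> in
  the first two variables isolates a single coefficient of a form.\<close>

lemma coeff3_shear_eq_0:
  assumes F: "homogeneous d F"
    and van: "\<And>a b. a + b < r \<Longrightarrow>
      eval3 ((deriv_X ^^ a) ((deriv_Y ^^ b) F)) (vector [p, q, 1]) = 0"
    and ab: "a + b < r"
  shows "coeff3 a b c (shear p q F) = 0"
proof (cases "a + b + c = d")
  case True
  define G where "G = shear p q F"
  define H where "H = (deriv_X ^^ a) ((deriv_Y ^^ b) G)"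
  have "(deriv_Y ^^ b) G = shear p q ((deriv_Y ^^ b) F)"
    unfolding G_def by (induction b) (simp_all add: deriv_Y_shear)
  moreover have "(deriv_X ^^ a) (shear p q E) = shear p q ((deriv_X ^^ a) E)" for E
    by (induction a) (simp_all add: deriv_X_shear)
  ultimately have H: "H = shear p q ((deriv_X ^^ a) ((deriv_Y ^^ b) F))"
    by (simp add: H_def)
  have "eval3 H (vector [0, 0, 1]) = 0"
    using van[OF ab] by (simp add: H eval3_shear)
  then have sum0: "(\<Sum>i\<le>degree H. coeff3 0 0 i H) = 0"
    by (simp add: eval3_001)
  have coeff: "\<exists>k\<noteq>0. coeff3 0 0 i H = k * coeff3 a b i G" for i
  proof -
    obtain k where k: "k \<noteq> 0" "\<forall>E. coeff3 0 0 i ((deriv_X ^^ a) E) = k * coeff3 (0 + a) 0 i E"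
      using coeff3_deriv_X_funpow[where a = 0 and b = 0 and c = i and i = a] by blast
    obtain l where l: "l \<noteq> 0" "\<forall>E. coeff3 a 0 i ((deriv_Y ^^ b) E) = l * coeff3 a (0 + b) i E"
      using coeff3_deriv_Y_funpow[where a = a and b = 0 and c = i and i = b] by blast
    show ?thesis
      using k(1) l(1) unfolding H_def k(2)[rule_format, unfolded add_0] l(2)[rule_format, unfolded add_0]
      by (intro exI[of _ "k * l"]) simp
  qed
  \<comment> \<open>By homogeneity, once a and b are fixed only one exponent of z is possible, so
    the vanishing sum consists of a single term.\<close>
  have other: "coeff3 0 0 i H = 0" if "i \<noteq> c" for i
  proof -
    have "coeff3 a b i G = 0"
      unfolding G_def using that True by (intro homogeneous_coeff3[OF homogeneous_shear[OF F]]) simp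
    then show ?thesis
      using coeff[of i] by fastforce
  qed
  have "coeff3 0 0 c H = 0"
  proof (cases "c \<le> degree H")
    case True
    then have "(\<Sum>i\<le>degree H. coeff3 0 0 i H) = (\<Sum>i\<in>{c}. coeff3 0 0 i H)"
      by (intro sum.mono_neutral_right) (use other in simp_all)
    then show ?thesis
      using sum0 by simp
  qed (simp add: coeff_eq_0)
  then show ?thesis
    using coeff[of c] unfolding G_def by fastforce
next
  case False
  then show ?thesis
    by (rule homogeneous_coeff3[OF homogeneous_shear[OF F]])
qed

text \<open>After the shear, multiplicity \<open>d - 1\<close> at (0 : 0 : 1) kills all coefficients
  with a + b < d - 1, that is c \<ge> 2. The terms with c = 0 and c = 1 are the forms A and
  B.\<close>

lemma eval3_large_multiplicity:
  assumes F: "homogeneous d F" and "d \<ge> 1"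
    and van: "\<And>a b. a + b < d - 1 \<Longrightarrow>
      eval3 ((deriv_X ^^ a) ((deriv_Y ^^ b) F)) (vector [p, q, 1]) = 0"
  defines "G \<equiv> shear p q F"
  defines "x \<equiv> \<lambda>v::complex^3. v $ 1 - p * v $ 3" and "y \<equiv> \<lambda>v::complex^3. v $ 2 - q * v $ 3"
  shows "eval3 F v = (\<Sum>b\<le>d. coeff3 (d-b) b 0 G * x v ^ (d-b) * y v ^ b)
    + v $ 3 * (\<Sum>b\<le>d-1. coeff3 (d-1-b) b 1 G * x v ^ (d-1-b) * y v ^ b)"
proof -
  have G: "homogeneous d G"
    unfolding G_def by (rule homogeneous_shear[OF F])
  let ?t = "\<lambda>c. \<Sum>b\<le>d-c. coeff3 (d-c-b) b c G * x v ^ (d-c-b) * y v ^ b * v $ 3 ^ c"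
  have "eval3 F v = eval3 F (vector [v $ 1, v $ 2, v $ 3])"
    by (rule arg_cong[where f = "eval3 F"]) (simp add: vec_eq_iff forall_3)
  then have "eval3 F v = eval3 G (vector [x v, y v, v $ 3])"
    by (simp add: G_def eval3_shear x_def y_def)
  also have "\<dots> = (\<Sum>c\<le>d. ?t c)"
    by (simp add: eval3_homogeneous[OF G])
  also have "\<dots> = (\<Sum>c\<in>{0, 1}. ?t c)"
  proof (rule sum.mono_neutral_right)
    show "\<forall>c\<in>{..d} - {0, 1}. ?t c = 0"
    proof (intro ballI sum.neutral)
      fix c b assume "c \<in> {..d} - {0, 1}" "b \<in> {..d-c}"
      then have "(d - c - b) + b < d - 1"
        by auto
      then show "coeff3 (d-c-b) b c G * x v ^ (d-c-b) * y v ^ b * v $ 3 ^ c = 0"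
        unfolding G_def using coeff3_shear_eq_0[OF F van] by simp
    qed
  qed (use \<open>d \<ge> 1\<close> in auto)
  finally show ?thesis
    by (simp add: sum_distrib_left mult_ac)
qed

text \<open>Zeros with x \<noteq> 0 become distinct roots y / x of the dehomogenized polynomial. By
  \<open>det\<close> at most one zero has x = 0; it costs one root, but it forces
  \<open>c d = 0\<close> and so lowers the degree bound by one as well.\<close>

lemma binary_form_eq_0:
  fixes c :: "nat \<Rightarrow> 'a::field"
  assumes fin: "finite S" and card: "d < card S"
    and zero: "\<And>x y. (x, y) \<in> S \<Longrightarrow> (\<Sum>b\<le>d. c b * x ^ (d - b) * y ^ b) = 0"
    and nz: "(0, 0) \<notin> S"
    and det: "\<And>x y x' y'. (x, y) \<in> S \<Longrightarrow> (x', y') \<in> S \<Longrightarrow> (x, y) \<noteq> (x', y') \<Longrightarrow> x * y' \<noteq> x' * y"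
    and "b \<le> d"
  shows "c b = 0"
proof -
  define T where "T = {v \<in> S. fst v \<noteq> 0}"
  define P where "P = (\<Sum>b\<le>d. monom (c b) b)"
  have coeff: "coeff P i = (if i \<le> d then c i else 0)" for i
    by (auto simp: P_def coeff_sum coeff_monom)
  have root: "poly P (y / x) = 0" if "(x, y) \<in> T" for x y
  proof -
    have "x \<noteq> 0" "(\<Sum>b\<le>d. c b * x ^ (d - b) * y ^ b) = 0"
      using that zero by (auto simp: T_def)
    moreover have "(\<Sum>b\<le>d. c b * x ^ (d - b) * y ^ b) = x ^ d * poly P (y / x)"
      using \<open>x \<noteq> 0\<close> unfolding P_def poly_sum poly_monom sum_distrib_left
      by (intro sum.cong refl) (simp add: power_divide power_diff)
    ultimately show ?thesis
      by simp
  qed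
  have inj: "inj_on (\<lambda>(x, y). y / x) T"
  proof (rule inj_onI, clarify)
    fix x y x' y' assume *: "(x, y) \<in> T" "(x', y') \<in> T" "y / x = y' / x'"
    then have "x * y' = x' * y"
      by (auto simp: T_def field_simps)
    then show "x = x' \<and> y = y'"
      using * det[of x y x' y'] by (auto simp: T_def)
  qed
  have P0: "P = 0" if "degree P < card T"
  proof (rule poly_eqI_degree)
    let ?R = "(\<lambda>(x, y). y / x) ` T"
    have "card ?R = card T"
      using inj by (rule card_image)
    then show "degree P < card ?R" "degree 0 < card ?R"
      using that by simp_all
    show "poly P x = poly 0 x" if "x \<in> ?R" for x
      using that root by auto
  qed
  have "P = 0"
  proof (cases "T = S")
    case True
    moreover have "degree P \<le> d"
      by (intro degree_le) (simp add: coeff)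
    ultimately show ?thesis
      using P0 card by simp
  next
    case False
    then obtain y where y: "(0, y) \<in> S"
      unfolding T_def by fastforce
    then have "y \<noteq> 0"
      using nz by auto
    have "T = S - {(0, y)}"
    proof (rule set_eqI)
      fix v :: "'a \<times> 'a"
      show "v \<in> T \<longleftrightarrow> v \<in> S - {(0, y)}"
        using det[OF y, of "fst v" "snd v"] by (cases v) (auto simp: T_def)
    qed
    then have cT: "card T \<ge> d"
      using y card fin by simp
    have "(\<Sum>b\<le>d. c b * 0 ^ (d - b) * y ^ b) = c d * y ^ d"
      by (subst sum.mono_neutral_right[where S = "{d}"]) auto
    then have "c d = 0"
      using zero[OF y] \<open>y \<noteq> 0\<close> by simp
    show ?thesis
    proof (cases d)
      case 0
      then show ?thesis
        using \<open>c d = 0\<close> by (intro poly_eqI) (simp add: coeff)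
    next
      case (Suc e)
      have "degree P \<le> e"
        using \<open>c d = 0\<close> Suc by (intro degree_le) (auto simp: coeff le_Suc_eq)
      then show ?thesis
        using P0 cT Suc by simp
    qed
  qed
  then show ?thesis
    using coeff[of b] \<open>b \<le> d\<close> by simp
qed

section \<open>Coordinates on the plane\<close>

definition proj :: "complex ^ 3 \<Rightarrow> proj2" where
  "proj v = Abs_proj2 {c *s v | c. c \<noteq> 0}"

lemma coords_proj: "v \<noteq> 0 \<Longrightarrow> coords (proj v) = {c *s v | c. c \<noteq> 0}"
  unfolding proj_def by (rule Abs_proj2_inverse) blast

lemma self_in_coords_proj: "v \<noteq> 0 \<Longrightarrow> v \<in> coords (proj v)"
  unfolding coords_proj by (auto intro!: exI[of _ 1])

lemma proj_cases: obtains v where "v \<noteq> 0" "p = proj v"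
proof -
  obtain v where v: "v \<noteq> 0" "coords p = {c *s v | c. c \<noteq> 0}"
    using coords[of p] by auto
  then have "p = proj v"
    using coords_inverse[of p] by (simp add: proj_def)
  then show ?thesis
    using that v(1) by blast
qed

lemma proj_scale:
  assumes "k \<noteq> 0"
  shows "proj (k *s v) = proj v"
proof -
  have "{c *s (k *s v) | c. c \<noteq> 0} = {c *s v | c. c \<noteq> 0}"
  proof (intro set_eqI iffI; clarify)
    fix c :: complex assume "c \<noteq> 0"
    show "\<exists>c'. c *s (k *s v) = c' *s v \<and> c' \<noteq> 0"
      using \<open>c \<noteq> 0\<close> assms by (intro exI[of _ "c * k"]) simp
    show "\<exists>c'. c *s v = c' *s (k *s v) \<and> c' \<noteq> 0"
      using \<open>c \<noteq> 0\<close> assms by (intro exI[of _ "c / k"]) simp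
  qed
  then show ?thesis
    by (simp add: proj_def)
qed

lemma proj_in_zero_locus:
  assumes "homogeneous d F" "v \<noteq> 0"
  shows "proj v \<in> zero_locus F \<longleftrightarrow> eval3 F v = 0"
proof -
  have "eval3 F v = 0" if "\<And>c. c \<noteq> 0 \<Longrightarrow> eval3 F (c *s v) = 0"
    using that[of 1] by simp
  then show ?thesis
    using homogeneous_eval3[OF assms(1)] unfolding zero_locus_def
    by (auto simp: coords_proj[OF \<open>v \<noteq> 0\<close>])
qed

definition dot3 :: "complex ^ 3 \<Rightarrow> complex ^ 3 \<Rightarrow> complex" where
  "dot3 u v = u $ 1 * v $ 1 + u $ 2 * v $ 2 + u $ 3 * v $ 3"

lemma proj_in_dual_line:
  assumes "u \<noteq> 0" "v \<noteq> 0"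
  shows "proj v \<in> dual_line (proj u) \<longleftrightarrow> dot3 u v = 0"
proof -
  have "dot3 (a *s u) (b *s v) = a * b * dot3 u v" for a b
    by (simp add: dot3_def algebra_simps)
  moreover have "u \<in> coords (proj u)" "v \<in> coords (proj v)"
    using assms by (simp_all add: self_in_coords_proj)
  moreover have "proj v \<in> dual_line (proj u)
      \<longleftrightarrow> (\<forall>u'\<in>coords (proj u). \<forall>v'\<in>coords (proj v). dot3 u' v' = 0)"
    by (simp add: dual_line_def dot3_def)
  ultimately show ?thesis
    unfolding coords_proj[OF assms(1)] coords_proj[OF assms(2)] by fastforce
qed

lemma genericallyI:
  assumes G: "homogeneous d G" "G \<noteq> 0" and P: "\<And>q. q \<notin> zero_locus G \<Longrightarrow> P q"
  shows "generically P"
  unfolding generically_def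
proof (intro exI conjI)
  show "zariski_open (- zero_locus G)"
    unfolding zariski_open_def zariski_closed_def using G by (intro exI[of _ "{G}"]) auto
  \<comment> \<open>The factor \<open>X\<close> forces the vector found below to be nonzero, even if
    \<open>G\<close> is a constant.\<close>
  have "X * G \<noteq> 0"
    using G by (auto simp: X_def)
  then obtain v where v: "eval3 (X * G) v \<noteq> 0"
    using eval3_eq_0 by blast
  then have "v \<noteq> 0" "eval3 G v \<noteq> 0"
    by auto
  then have "proj v \<in> - zero_locus G"
    using proj_in_zero_locus[OF G(1)] by simp
  then show "- zero_locus G \<noteq> {}"
    by blast
qed (use P in auto)

text \<open>Among the forms that cut out the closed complement, one does not vanish at a chosen
  point of the open set; its nonvanishing locus lies in the open set.\<close>

lemma genericallyE:
  assumes "generically P"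
  shows "\<exists>d G. homogeneous d G \<and> G \<noteq> 0 \<and> (\<forall>q. q \<notin> zero_locus G \<longrightarrow> P q)"
proof -
  obtain U p where U: "zariski_open U" "p \<in> U" "\<And>q. q \<in> U \<Longrightarrow> P q"
    using assms unfolding generically_def by auto
  then obtain \<F> where \<F>: "\<forall>F\<in>\<F>. \<exists>d. homogeneous d F" "- U = (\<Inter>F\<in>\<F>. zero_locus F)"
    unfolding zariski_open_def zariski_closed_def by auto
  then obtain F where F: "F \<in> \<F>" "p \<notin> zero_locus F"
    using U(2) by blast
  moreover have "F \<noteq> 0"
    using F(2) by (auto simp: zero_locus_def)
  moreover have "P q" if "q \<notin> zero_locus F" for q
    using that F(1) \<F>(2) U(3) by blast
  ultimately show ?thesis
    using \<F>(1) by blast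
qed

lemma generically_mono: "generically P \<Longrightarrow> (\<And>q. P q \<Longrightarrow> Q q) \<Longrightarrow> generically Q"
  unfolding generically_def by blast

text \<open>The plane is irreducible: the product of two nonzero forms is nonzero, so it has a point
  outside both zero loci.\<close>

lemma generically_meet:
  assumes "generically P" "generically Q"
  shows "\<exists>q. P q \<and> Q q"
proof -
  obtain d G where G: "homogeneous d G" "G \<noteq> 0" "\<And>q. q \<notin> zero_locus G \<Longrightarrow> P q"
    using genericallyE[OF assms(1)] by auto
  obtain e H where H: "homogeneous e H" "H \<noteq> 0" "\<And>q. q \<notin> zero_locus H \<Longrightarrow> Q q"
    using genericallyE[OF assms(2)] by auto
  have "X * (G * H) \<noteq> 0"
    using G(2) H(2) by (auto simp: X_def)
  then obtain v where v: "eval3 (X * (G * H)) v \<noteq> 0"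
    using eval3_eq_0 by blast
  then have "v \<noteq> 0" "eval3 G v \<noteq> 0" "eval3 H v \<noteq> 0"
    by auto
  then have "P (proj v) \<and> Q (proj v)"
    using proj_in_zero_locus[OF G(1)] proj_in_zero_locus[OF H(1)] G(3) H(3) by simp
  then show ?thesis ..
qed

section \<open>Order of vanishing\<close>

text \<open>The \<open>r\<close>-th power of the ideal generated by the polynomials vanishing at \<open>v\<close>.\<close>

inductive in_ideal_power :: "complex ^ 3 \<Rightarrow> nat \<Rightarrow> cpoly3 \<Rightarrow> bool" for v where
  zero: "in_ideal_power v 0 F"
| step: "in_ideal_power v r F \<Longrightarrow> eval3 L v = 0 \<Longrightarrow> in_ideal_power v (Suc r) (F * L)"
| add: "in_ideal_power v r F \<Longrightarrow> in_ideal_power v r G \<Longrightarrow> in_ideal_power v r (F + G)"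

lemma in_ideal_power_mult: "in_ideal_power v r F \<Longrightarrow> in_ideal_power v r (F * G)"
proof (induction rule: in_ideal_power.induct)
  case (step r F L)
  then show ?case
    using in_ideal_power.step[of v r "F * G" L] by (simp add: mult_ac)
qed (auto intro: in_ideal_power.intros simp: distrib_right)

lemma in_ideal_power_power: "eval3 L v = 0 \<Longrightarrow> in_ideal_power v r (F * L ^ r)"
proof (induction r)
  case (Suc r)
  then show ?case
    using in_ideal_power.step[of v r "F * L ^ r" L] by (simp add: mult_ac)
qed (simp add: in_ideal_power.zero)

lemma eval3_in_ideal_power: "in_ideal_power v r F \<Longrightarrow> r > 0 \<Longrightarrow> eval3 F v = 0"
  by (induction rule: in_ideal_power.induct) simp_all

text \<open>By the Leibniz rule a derivation removes at most one of the r factors that vanish at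
  \<open>v\<close>.\<close>

lemma in_ideal_power_derivation:
  assumes D: "\<And>F G. D (F + G) = D F + D G" "\<And>F G. D (F * G) = D F * G + F * D G"
    and F: "in_ideal_power v r F"
  shows "in_ideal_power v (r - 1) (D F)"
  using F
proof (induction rule: in_ideal_power.induct)
  case (step r F L)
  have "in_ideal_power v r (D F * L)"
  proof (cases r)
    case (Suc s)
    then show ?thesis
      using in_ideal_power.step[of v s "D F" L] step by simp
  qed (simp add: in_ideal_power.zero)
  then show ?case
    using in_ideal_power_mult[OF step(1)] by (auto simp: D intro: in_ideal_power.add)
qed (auto simp: D intro: in_ideal_power.intros)

lemma in_ideal_power_derivation_funpow:
  assumes D: "\<And>F G. D (F + G) = D F + D G" "\<And>F G. D (F * G) = D F * G + F * D G"
    and F: "in_ideal_power v r F"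
  shows "in_ideal_power v (r - a) ((D ^^ a) F)"
proof (induction a)
  case (Suc a)
  then show ?case
    using in_ideal_power_derivation[of D, OF D Suc] by simp
qed (simp add: F)

text \<open>Fewer than r derivations leave a positive power of the ideal, whose elements vanish at
  the point.\<close>

lemma vanishes_to_orderI:
  assumes "\<And>v. v \<in> coords p \<Longrightarrow> in_ideal_power v r F"
  shows "vanishes_to_order r F p"
  unfolding vanishes_to_order_def
proof (intro allI impI ballI)
  fix a b c v assume abc: "a + b + c < r" and "v \<in> coords p"
  then have "in_ideal_power v r F"
    using assms by simp
  then have "in_ideal_power v (r - c - b - a) ((deriv_X ^^ a) ((deriv_Y ^^ b) ((deriv_Z ^^ c) F)))"
    by (intro in_ideal_power_derivation_funpow deriv_X_add deriv_Y_add deriv_Z_add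
        deriv_X_mult deriv_Y_mult deriv_Z_mult)
  then show "eval3 ((deriv_X ^^ a) ((deriv_Y ^^ b) ((deriv_Z ^^ c) F))) v = 0"
    using abc by (intro eval3_in_ideal_power) auto
qed

section \<open>Polynomials that are linear in one variable\<close>

text \<open>If y does not occur, a root in x is paired with y = 1. Otherwise some x \<noteq> 0 keeps
  the leading coefficient in y nonzero, and the equation is solved for y. The zero has to differ
  from the origin, where forms of positive degree vanish anyway.\<close>

lemma nonunit_has_zero:
  fixes g :: "complex poly poly"
  assumes "g \<noteq> 0" "\<not> g dvd 1"
  obtains x y where "(x, y) \<noteq> (0, 0)" "poly (poly g [:y:]) x = 0"
proof (cases "degree g = 0")
  case True
  then obtain h where h: "g = [:h:]"
    by (rule degree_eq_zeroE)
  then have "h \<noteq> 0" "\<not> h dvd 1"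
    using assms by (simp_all add: is_unit_const_poly_iff)
  then have "degree h > 0"
    by (simp add: is_unit_iff_degree)
  from alg_closed_imp_poly_has_root[OF this] obtain x where "poly h x = 0" ..
  then show ?thesis
    using that[of x 1] h by simp
next
  case False
  have "finite ({x. poly (lead_coeff g) x = 0} \<union> {0})"
    using assms(1) by (simp add: poly_roots_finite)
  then obtain x where x: "poly (lead_coeff g) x \<noteq> 0" "x \<noteq> 0"
    using ex_new_if_finite[OF infinite_UNIV_char_0, of "{x. poly (lead_coeff g) x = 0} \<union> {0}"] by auto
  let ?h = "map_poly (\<lambda>p. poly p x) g"
  have eval: "poly (map_poly (\<lambda>p. poly p x) g) y = poly (poly g [:y:]) x" for y
    by (induction g) (simp_all add: map_poly_pCons)
  have "coeff ?h (degree g) \<noteq> 0"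
    using x(1) by (simp add: coeff_map_poly)
  then have "degree ?h > 0"
    using False le_degree by fastforce
  from alg_closed_imp_poly_has_root[OF this] obtain y where "poly ?h y = 0" ..
  then show ?thesis
    using that[of x y] x(2) eval by simp
qed

text \<open>Degrees in the outer variable add up to 1, so one factor is free of that variable and
  divides both \<open>A\<close> and \<open>B\<close>. If it were not a unit, it would give them a
  common zero besides the origin.\<close>

lemma irreducible_linear:
  fixes A B :: "complex poly poly"
  assumes "B \<noteq> 0"
    and no_zero: "\<And>x y. poly (poly A [:y:]) x = 0 \<Longrightarrow> poly (poly B [:y:]) x = 0 \<Longrightarrow> (x, y) = (0, 0)"
  shows "irreducible [:A, B:]"
proof (rule irreducibleI)
  have deg: "degree [:A, B:] = 1"
    using \<open>B \<noteq> 0\<close> by simp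
  show "[:A, B:] \<noteq> 0"
    using \<open>B \<noteq> 0\<close> by simp
  show "\<not> [:A, B:] dvd 1"
    using \<open>B \<noteq> 0\<close> by (auto simp: is_unit_poly_iff)
  have unit: "G dvd 1" if GH: "G * H = [:A, B:]" "degree G = 0" for G H
  proof -
    obtain g where g: "G = [:g:]"
      using GH(2) by (rule degree_eq_zeroE)
    then have "[:g:] dvd [:A, B:]"
      using GH(1) by (metis dvd_triv_left)
    then have "g dvd coeff [:A, B:] i" for i
      by (simp add: const_poly_dvd_iff)
    from this[of 0] this[of 1] have "g dvd A" "g dvd B"
      by simp_all
    then obtain A' B' where AB: "A = g * A'" "B = g * B'"
      by (auto elim!: dvdE)
    then have "g \<noteq> 0"
      using \<open>B \<noteq> 0\<close> by auto
    have "g dvd 1"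
    proof (rule ccontr)
      assume "\<not> g dvd 1"
      then obtain x y where "(x, y) \<noteq> (0, 0)" "poly (poly g [:y:]) x = 0"
        using nonunit_has_zero \<open>g \<noteq> 0\<close> by blast
      then show False
        using no_zero[of y x] by (simp add: AB)
    qed
    then show ?thesis
      by (simp add: g is_unit_const_poly_iff)
  qed
  show "G dvd 1 \<or> H dvd 1" if eq: "[:A, B:] = G * H" for G H
  proof -
    have "G \<noteq> 0" "H \<noteq> 0"
      using eq \<open>B \<noteq> 0\<close> by auto
    then have "degree G + degree H = 1"
      using deg eq by (simp add: degree_mult_eq)
    then consider "degree G = 0" | "degree H = 0"
      by linarith
    then show ?thesis
      using unit[of G H] unit[of H G] eq by cases (simp_all add: mult.commute)
  qed
qed

section \<open>Dimensions\<close>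

text \<open>The functionals are packed into one linear map into polynomials in z, with a separate
  power of \<open>Z\<close> for each index. It is injective on \<open>V\<close>, so a basis of
  \<open>V\<close> maps to an independent set in the span of \<open>card I\<close> vectors.\<close>

lemma
  fixes f :: "'i \<Rightarrow> cpoly3 \<Rightarrow> complex"
  assumes I: "finite I" and V: "cpoly3.subspace V"
    and add: "\<And>i F G. i \<in> I \<Longrightarrow> f i (F + G) = f i F + f i G"
    and scale: "\<And>i c F. i \<in> I \<Longrightarrow> f i (scale3 c F) = c * f i F"
    and sep: "\<And>F. F \<in> V \<Longrightarrow> (\<And>i. i \<in> I \<Longrightarrow> f i F = 0) \<Longrightarrow> F = 0"
  shows dim_le_card_functionals: "cpoly3.dim V \<le> card I"
    and dim_pos: "F \<in> V \<Longrightarrow> F \<noteq> 0 \<Longrightarrow> cpoly3.dim V > 0"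
proof -
  obtain g :: "'i \<Rightarrow> nat" where g: "inj_on g I"
    using finite_imp_inj_to_nat_seg[OF I] by blast
  define \<Phi> where "\<Phi> F = (\<Sum>i\<in>I. scale3 (f i F) (Z ^ g i))" for F
  interpret vector_space_pair scale3 scale3 ..
  have lin: "Vector_Spaces.linear scale3 scale3 \<Phi>"
    unfolding Vector_Spaces.linear_iff
    by (auto simp: \<Phi>_def add scale cpoly3.scale_left_distrib sum.distrib cpoly3.scale_sum_right
        intro: cpoly3.vector_space_axioms)
  have inj: "inj_on \<Phi> V"
  proof -
    have "F = 0" if "F \<in> V" "\<Phi> F = 0" for F
    proof (rule sep[OF that(1)])
      fix i assume "i \<in> I"
      have Zpow: "Z ^ e = monom 1 e" for e
        by (simp add: Z_def monom_altdef)
      have "coeff (\<Phi> F) (g i) = (\<Sum>j\<in>I. if j = i then [:[:f i F:]:] else 0)"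
        unfolding \<Phi>_def coeff_sum
        by (intro sum.cong refl)
           (use inj_on_eq_iff[OF g] \<open>i \<in> I\<close> in \<open>auto simp: scale3_def const3_def Zpow coeff_monom\<close>)
      then show "f i F = 0"
        using \<open>i \<in> I\<close> I that(2) by simp
    qed
    then show ?thesis
      using linear_inj_on_iff_eq_0[OF lin V] by blast
  qed
  obtain B where B: "B \<subseteq> V" "cpoly3.independent B" "V \<subseteq> cpoly3.span B" "card B = cpoly3.dim V"
    by (rule cpoly3.basis_exists)
  have span: "cpoly3.span B \<subseteq> V"
    using B(1) V by (rule cpoly3.span_minimal)
  have "cpoly3.independent (\<Phi> ` B)"
    using lin B(2) inj_on_subset[OF inj span] by (rule linear_independent_injective_image)
  moreover have "\<Phi> ` B \<subseteq> cpoly3.span ((\<lambda>i. Z ^ g i) ` I)"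
    unfolding \<Phi>_def
    by (intro image_subsetI cpoly3.span_sum cpoly3.span_scale cpoly3.span_base imageI)
  ultimately have fin: "finite (\<Phi> ` B)" "card (\<Phi> ` B) \<le> card ((\<lambda>i. Z ^ g i) ` I)"
    using cpoly3.independent_span_bound[of "(\<lambda>i. Z ^ g i) ` I" "\<Phi> ` B"] I by auto
  have injB: "inj_on \<Phi> B"
    using inj B(1) inj_on_subset by blast
  show "cpoly3.dim V \<le> card I"
    using fin(2) card_image_le[OF I, of "\<lambda>i. Z ^ g i"] card_image[OF injB] B(4) by simp
  show "cpoly3.dim V > 0" if "F \<in> V" "F \<noteq> 0"
  proof -
    \<comment> \<open>Finiteness is essential for positivity, since the cardinality of an infinite
      basis would be 0.\<close>
    have "finite B"
      using fin(1) injB by (simp add: finite_image_iff)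
    moreover have "B \<noteq> {}"
      using that B(3) by auto
    ultimately show ?thesis
      using B(4) card_gt_0_iff by metis
  qed
qed

lemma deriv_const_mult:
  "deriv_X (const3 c * F) = const3 c * deriv_X F"
  "deriv_Y (const3 c * F) = const3 c * deriv_Y F"
  "deriv_Z (const3 c * F) = const3 c * deriv_Z F"
  by (simp_all add: deriv_X_mult deriv_Y_mult deriv_Z_mult deriv_basics)

lemma deriv_funpow_linear:
  "(deriv_X ^^ a) (F + G) = (deriv_X ^^ a) F + (deriv_X ^^ a) G"
  "(deriv_Y ^^ a) (F + G) = (deriv_Y ^^ a) F + (deriv_Y ^^ a) G"
  "(deriv_Z ^^ a) (F + G) = (deriv_Z ^^ a) F + (deriv_Z ^^ a) G"
  "(deriv_X ^^ a) (const3 c * F) = const3 c * (deriv_X ^^ a) F"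
  "(deriv_Y ^^ a) (const3 c * F) = const3 c * (deriv_Y ^^ a) F"
  "(deriv_Z ^^ a) (const3 c * F) = const3 c * (deriv_Z ^^ a) F"
  by (induction a) (simp_all add: deriv_X_add deriv_Y_add deriv_Z_add deriv_const_mult)

lemma sum_times_power_0:
  fixes g :: "nat \<Rightarrow> 'a::comm_semiring_1"
  shows "(\<Sum>c\<le>d. g c * 0 ^ c) = g 0"
proof -
  have "(\<Sum>c\<le>d. g c * 0 ^ c) = (\<Sum>c\<le>d. if c = 0 then g 0 else 0)"
    by (intro sum.cong) (auto simp: zero_power)
  then show ?thesis
    by simp
qed

lemma sum_times_power_diff_0:
  fixes g :: "nat \<Rightarrow> 'a::comm_semiring_1"
  shows "(\<Sum>b\<le>d. g b * 0 ^ (d - b)) = g d"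
proof -
  have "(\<Sum>b\<le>d. g b * 0 ^ (d - b)) = (\<Sum>b\<le>d. if b = d then g d else 0)"
    by (intro sum.cong) (auto simp: zero_power)
  then show ?thesis
    by simp
qed

text \<open>With \<open>0 ^ 0 = 1\<close>, setting a variable to 0 leaves exactly the monomials free
  of it.\<close>

lemma eval3_side:
  assumes "homogeneous d F"
  shows "eval3 F (vector [x, y, 0]) = (\<Sum>b\<le>d. coeff3 (d - b) b 0 F * x ^ (d - b) * y ^ b)"
    and "eval3 F (vector [x, 0, z]) = (\<Sum>c\<le>d. coeff3 (d - c) 0 c F * x ^ (d - c) * z ^ c)"
    and "eval3 F (vector [0, y, z]) = (\<Sum>c\<le>d. coeff3 0 (d - c) c F * y ^ (d - c) * z ^ c)"
proof -
  note eval = eval3_homogeneous[OF assms]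
  show "eval3 F (vector [x, y, 0]) = (\<Sum>b\<le>d. coeff3 (d - b) b 0 F * x ^ (d - b) * y ^ b)"
    unfolding eval vector_3 sum_distrib_right[symmetric] sum_times_power_0 by simp
  show "eval3 F (vector [x, 0, z]) = (\<Sum>c\<le>d. coeff3 (d - c) 0 c F * x ^ (d - c) * z ^ c)"
    unfolding eval vector_3 sum_distrib_right[symmetric] sum_times_power_0 by simp
  have "(\<Sum>b\<le>d-c. coeff3 (d-c-b) b c F * 0 ^ (d-c-b) * y ^ b) = coeff3 0 (d-c) c F * y ^ (d-c)" for c
    using sum_times_power_diff_0[of "\<lambda>b. coeff3 (d-c-b) b c F * y ^ b" "d - c"] by (simp add: mult_ac)
  then show "eval3 F (vector [0, y, z]) = (\<Sum>c\<le>d. coeff3 0 (d - c) c F * y ^ (d - c) * z ^ c)"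
    unfolding eval vector_3 sum_distrib_right[symmetric] by simp
qed

text \<open>The step from N to N + 1 adds the N pairs on the diagonal a + b = N + 1. For N = m - 1
  the pairs index the monomials of degree m divisible by xyz.\<close>

lemma card_interior:
  shows "finite {(a, b). 1 \<le> a \<and> 1 \<le> b \<and> a + b \<le> (N::nat)}"
    and "card {(a, b). 1 \<le> a \<and> 1 \<le> b \<and> a + b \<le> (N::nat)} = N choose 2"
proof -
  let ?T = "\<lambda>N. {(a, b). 1 \<le> a \<and> 1 \<le> b \<and> a + b \<le> (N::nat)}"
  show fin: "finite (?T N)" for N
    by (rule finite_subset[of _ "{..N} \<times> {..N}"]) auto
  show "card (?T N) = N choose 2"
  proof (induction N)
    case 0
    have "?T 0 = {}"
      by auto
    then show ?case
      by (simp only: card.empty) simp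
  next
    case (Suc N)
    have "?T (Suc N) = ?T N \<union> (\<lambda>a. (a, Suc N - a)) ` {1..N}"
      by (auto simp: image_iff)
    moreover have "card ((\<lambda>a. (a, Suc N - a)) ` {1..N}) = N"
      by (subst card_image) (auto intro: inj_onI)
    moreover have "?T N \<inter> (\<lambda>a. (a, Suc N - a)) ` {1..N} = {}"
      by auto
    ultimately have "card (?T (Suc N)) = card (?T N) + N"
      using fin[of N] by (simp add: card_Un_disjoint)
    then show ?case
      using Suc by (simp add: numeral_2_eq_2)
  qed
qed

lemma subspace_sections: "cpoly3.subspace (sections j S)"
proof -
  have "F \<in> sections j S \<longleftrightarrow>
      (\<forall>k v. eval3 F (k *s v) = k ^ j * eval3 F v) \<and> (\<forall>p\<in>S. \<forall>v\<in>coords p. eval3 F v = 0)" for F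
    by (auto simp: sections_def zero_locus_def homogeneous_iff_eval3)
  then show ?thesis
    unfolding cpoly3.subspace_def by (simp add: scale3_def distrib_left)
qed

lemma subspace_sections_fat: "cpoly3.subspace (sections_fat j S r p)"
proof -
  have 0: "(deriv_X ^^ a) 0 = 0" "(deriv_Y ^^ a) 0 = 0" "(deriv_Z ^^ a) 0 = 0" for a
    using deriv_funpow_linear(4-6)[of a 0 0] by simp_all
  show ?thesis
    using subspace_sections[of j S]
    unfolding cpoly3.subspace_def sections_fat_def
    by (auto simp: vanishes_to_order_def scale3_def deriv_funpow_linear 0)
qed

section \<open>The arrangements\<close>

locale monomial_arrangement =
  fixes m k n :: nat and w :: "nat \<Rightarrow> complex"
  assumes m: "m \<ge> 5" and k: "2 \<le> k" and n: "n = m - 2"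
    and w: "\<And>i. i \<in> {1..k} \<Longrightarrow> w i ^ n = 1"
    and inj_w: "inj_on w {1..k}"
begin

section \<open>The dual points and their coordinate vectors\<close>

definition roots :: "complex set" where "roots = {\<zeta>. \<zeta> ^ n = 1}"

text \<open>One coordinate vector for each point of the set: the coefficient vectors of the linear
  factors of the arrangement.\<close>

definition normals :: "(complex ^ 3) set" where
  "normals = {vector [1, 0, 0], vector [0, 1, 0], vector [0, 0, 1]}
     \<union> (\<lambda>\<zeta>. vector [1, - \<zeta>, 0]) ` roots \<union> (\<lambda>\<zeta>. vector [1, 0, - \<zeta>]) ` roots
     \<union> (\<lambda>i. vector [0, - w i, 1]) ` {1..k}"

lemma n_ge_3: "n \<ge> 3" and m_eq: "m = n + 2"
  using m n by simp_all

lemma finite_roots: "finite roots"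
  and card_roots: "card roots = n"
  and root_nonzero: "\<zeta> \<in> roots \<Longrightarrow> \<zeta> \<noteq> 0"
  using n_ge_3 by (auto simp: roots_def card_roots_unity_eq zero_power finite_roots_unity)

lemma finite_normals: "finite normals"
  by (simp add: normals_def finite_roots)

lemma normal_nonzero: "u \<in> normals \<Longrightarrow> u \<noteq> 0"
  by (auto simp: normals_def vec_eq_iff forall_3)

lemma power_eq_iff_root: "x ^ n = y ^ n \<longleftrightarrow> (\<exists>\<zeta>\<in>roots. x = \<zeta> * y)" for x y :: complex
proof
  assume eq: "x ^ n = y ^ n"
  show "\<exists>\<zeta>\<in>roots. x = \<zeta> * y"
  proof (cases "y = 0")
    case True
    then show ?thesis
      using eq n_ge_3 by (intro bexI[of _ 1]) (simp_all add: roots_def zero_power)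
  next
    case False
    then show ?thesis
      using eq by (intro bexI[of _ "x / y"]) (simp_all add: roots_def power_divide)
  qed
qed (auto simp: roots_def power_mult_distrib)

lemma eval3_arrangement:
  "eval3 (arrangement_poly m k w) v = 0 \<longleftrightarrow> (\<exists>u\<in>normals. dot3 u v = 0)"
proof -
  have "eval3 (arrangement_poly m k w) v = 0 \<longleftrightarrow>
      v $ 1 = 0 \<or> v $ 2 = 0 \<or> v $ 3 = 0 \<or> v $ 1 ^ n = v $ 2 ^ n \<or> v $ 1 ^ n = v $ 3 ^ n
      \<or> (\<exists>i\<in>{1..k}. v $ 3 = w i * v $ 2)"
    by (simp add: arrangement_poly_def Let_def flip: n)
  also have "\<dots> \<longleftrightarrow> (\<exists>u\<in>normals. dot3 u v = 0)"
    unfolding power_eq_iff_root normals_def bex_Un bex_simps by (auto simp: dot3_def)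
  finally show ?thesis .
qed

text \<open>Evaluating the equation of the arrangement at the points \<open>u \<times> (1, t, t\<^sup>2)\<close> of the line
  dual to \<open>u\<close> gives a product of polynomials in \<open>t\<close>, one of which must be zero.\<close>

lemma Z_points_eq: "Z_points m k w = proj ` normals"
proof (intro set_eqI iffI)
  fix p assume "p \<in> Z_points m k w"
  obtain u where u: "u \<noteq> 0" "p = proj u"
    by (rule proj_cases)
  have on_line: "\<exists>l\<in>normals. dot3 l v = 0" if "dot3 u v = 0" for v
  proof (cases "v = 0")
    case True
    then show ?thesis
      by (auto simp: normals_def dot3_def)
  next
    case False
    then have "proj v \<in> dual_line p"
      using that u by (simp add: proj_in_dual_line)
    then have "proj v \<in> zero_locus (arrangement_poly m k w)"
      using \<open>p \<in> Z_points m k w\<close> by (auto simp: Z_points_def dual_points_def arrangement_lines_def)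
    then have "eval3 (arrangement_poly m k w) v = 0"
      using self_in_coords_proj[OF False] by (auto simp: zero_locus_def)
    then show ?thesis
      by (simp add: eval3_arrangement)
  qed
  \<comment> \<open>The coefficients are the entries of the cross product l \<times> u, since l
    \<cdot> (u \<times> s) = (l \<times> u) \<cdot> s with s = (1, t, t^2). Hence
    \<open>P l = 0\<close> makes \<open>l\<close> and \<open>u\<close> proportional.\<close>
  define P where "P l = [:l$2 * u$3 - l$3 * u$2, l$3 * u$1 - l$1 * u$3, l$1 * u$2 - l$2 * u$1:]"
    for l :: "complex ^ 3"
  have "poly (\<Prod>l\<in>normals. P l) t = 0" for t
  proof -
    let ?v = "vector [u$2 * t^2 - u$3 * t, u$3 - u$1 * t^2, u$1 * t - u$2] :: complex ^ 3"
    have "dot3 u ?v = 0"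
      by (simp add: dot3_def algebra_simps)
    then obtain l where "l \<in> normals" "dot3 l ?v = 0"
      using on_line by blast
    moreover have "dot3 l ?v = poly (P l) t"
      by (simp add: dot3_def P_def algebra_simps power2_eq_square)
    ultimately show ?thesis
      using finite_normals by (auto simp: poly_prod)
  qed
  then have "(\<Prod>l\<in>normals. P l) = 0"
    using poly_all_0_iff_0 by blast
  then obtain l where l: "l \<in> normals" "P l = 0"
    using finite_normals by auto
  have cross: "l$2 * u$3 = l$3 * u$2" "l$3 * u$1 = l$1 * u$3" "l$1 * u$2 = l$2 * u$1"
    using l(2) by (simp_all add: P_def)
  obtain i where i: "l $ i \<noteq> 0"
    using normal_nonzero[OF l(1)] by (auto simp: vec_eq_iff)
  have "l $ i * u $ j = l $ j * u $ i" for j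
    using exhaust_3[of i] exhaust_3[of j] cross by (auto simp: mult_ac)
  then have "u = (u $ i / l $ i) *s l"
    using i by (simp add: vec_eq_iff field_simps)
  moreover from this have "u $ i / l $ i \<noteq> 0"
    using u(1) by (metis vector_smult_lzero)
  ultimately show "p \<in> proj ` normals"
    using l(1) u(2) proj_scale by (metis imageI)
next
  fix p assume "p \<in> proj ` normals"
  then obtain u where u: "u \<in> normals" "p = proj u"
    by auto
  have "q \<in> zero_locus (arrangement_poly m k w)" if "q \<in> dual_line p" for q
    unfolding zero_locus_def
  proof (intro CollectI ballI)
    fix v assume "v \<in> coords q"
    then have "dot3 u v = 0"
      using that u self_in_coords_proj[OF normal_nonzero[OF u(1)]]
      by (auto simp: dual_line_def dot3_def)
    then show "eval3 (arrangement_poly m k w) v = 0"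
      using u(1) eval3_arrangement by blast
  qed
  then show "p \<in> Z_points m k w"
    by (auto simp: Z_points_def dual_points_def arrangement_lines_def)
qed

lemma sections_iff:
  "F \<in> sections j (Z_points m k w) \<longleftrightarrow> homogeneous j F \<and> (\<forall>u\<in>normals. eval3 F u = 0)"
  unfolding sections_def Z_points_eq using proj_in_zero_locus[of j F] normal_nonzero by auto

section \<open>General points of the plane\<close>

text \<open>The finitely many lines with coefficients 0 or n-th roots of unity include all lines
  that the point must avoid, both for uniqueness and for irreducibility.\<close>

definition avoids :: "complex \<Rightarrow> complex \<Rightarrow> bool" where
  "avoids p q \<longleftrightarrow> (\<forall>u :: complex ^ 3. u \<noteq> 0 \<longrightarrow> (\<forall>i. u $ i = 0 \<or> u $ i \<in> roots) \<longrightarrow>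
     dot3 u (vector [p, q, 1]) \<noteq> 0)"

lemma avoidsD:
  assumes "avoids p q" "a = 0 \<or> a \<in> roots" "b = 0 \<or> b \<in> roots" "c = 0 \<or> c \<in> roots"
    and "a \<noteq> 0 \<or> b \<noteq> 0 \<or> c \<noteq> 0"
  shows "a * p + b * q + c \<noteq> 0"
proof -
  have "(vector [a, b, c] :: complex ^ 3) \<noteq> 0"
    using assms(5) by (auto simp: vec_eq_iff forall_3)
  moreover have "\<forall>i. vector [a, b, c] $ (i::3) = 0 \<or> vector [a, b, c] $ i \<in> roots"
    using assms(2-4) by (simp add: forall_3)
  ultimately have "dot3 (vector [a, b, c]) (vector [p, q, 1]) \<noteq> 0"
    using assms(1) unfolding avoids_def by blast
  then show ?thesis
    by (simp add: dot3_def)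
qed

lemma one_root: "1 \<in> roots"
  by (simp add: roots_def)

lemma root_mult: "\<zeta> \<in> roots \<Longrightarrow> \<eta> \<in> roots \<Longrightarrow> \<zeta> * \<eta> \<in> roots"
  by (simp add: roots_def power_mult_distrib)

lemma w_root: "i \<in> {1..k} \<Longrightarrow> w i \<in> roots"
  using w by (simp add: roots_def)

lemma generically_avoids: "generically (\<lambda>Q. \<exists>p q. Q = proj (vector [p, q, 1]) \<and> avoids p q)"
proof -
  define U :: "(complex ^ 3) set" where "U = {u. u \<noteq> 0 \<and> (\<forall>i. u $ i = 0 \<or> u $ i \<in> roots)}"
  define l where "l u = const3 (u$1) * X + const3 (u$2) * Y + const3 (u$3) * Z" for u :: "complex ^ 3"
  have l: "eval3 (l u) v = dot3 u v" for u v
    by (simp add: l_def dot3_def)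
  have "U \<subseteq> (\<lambda>(a, b, c). vector [a, b, c]) ` (insert 0 roots \<times> insert 0 roots \<times> insert 0 roots)"
  proof
    fix u assume "u \<in> U"
    then have "u = (\<lambda>(a, b, c). vector [a, b, c]) (u$1, u$2, u$3)"
      "(u$1, u$2, u$3) \<in> insert 0 roots \<times> insert 0 roots \<times> insert 0 roots"
      by (auto simp: U_def vec_eq_iff forall_3)
    then show "u \<in> (\<lambda>(a, b, c). vector [a, b, c]) ` (insert 0 roots \<times> insert 0 roots \<times> insert 0 roots)"
      by (rule image_eqI)
  qed
  then have finU: "finite U"
    by (rule finite_subset) (simp add: finite_roots)
  show ?thesis
  proof (rule genericallyI)
    show hom: "homogeneous (card U) (\<Prod>u\<in>U. l u)"
      by (intro homogeneous_prod) (simp add: homogeneous_iff_eval3 l dot3_def algebra_simps)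
    have "l u \<noteq> 0" if "u \<in> U" for u
    proof
      assume "l u = 0"
      then have "dot3 u v = 0" for v
        by (metis l eval3_0)
      from this[of "vector [1, 0, 0]"] this[of "vector [0, 1, 0]"] this[of "vector [0, 0, 1]"]
      show False
        using that by (simp add: U_def dot3_def vec_eq_iff forall_3)
    qed
    then show "(\<Prod>u\<in>U. l u) \<noteq> 0"
      using finU by simp
    fix Q assume Q: "Q \<notin> zero_locus (\<Prod>u\<in>U. l u)"
    obtain v where v: "v \<noteq> 0" "Q = proj v"
      by (rule proj_cases)
    then have dot: "dot3 u v \<noteq> 0" if "u \<in> U" for u
      using Q that finU proj_in_zero_locus[OF hom v(1)] by (simp add: l)
    \<comment> \<open>The line z = 0 is among the excluded ones, so the third coordinate can be
      scaled to 1.\<close>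
    have "vector [0, 0, 1] \<in> U"
      by (simp add: U_def vec_eq_iff forall_3 one_root)
    then have v3: "v $ 3 \<noteq> 0"
      using dot by (force simp: dot3_def)
    let ?v = "vector [v$1 / v$3, v$2 / v$3, 1] :: complex ^ 3"
    have "v = v$3 *s ?v"
      using v3 by (simp add: vec_eq_iff forall_3)
    then have "Q = proj ?v"
      using v(2) proj_scale[OF v3] by metis
    moreover have "avoids (v$1 / v$3) (v$2 / v$3)"
      unfolding avoids_def
    proof (intro allI impI)
      fix u :: "complex ^ 3" assume "u \<noteq> 0" "\<forall>i. u $ i = 0 \<or> u $ i \<in> roots"
      then have "dot3 u v \<noteq> 0"
        using dot by (simp add: U_def)
      moreover have "dot3 u v = v$3 * dot3 u ?v"
        using v3 by (simp add: dot3_def field_simps)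
      ultimately show "dot3 u ?v \<noteq> 0"
        by auto
    qed
    ultimately show "\<exists>p q. Q = proj (vector [p, q, 1]) \<and> avoids p q"
      by blast
  qed
qed

section \<open>Vanishing and uniqueness of forms with a general multiple point\<close>

text \<open>Roots of unity have norm 1. Hence (1 : 2 : 0) is none of the points (1 : -\<zeta> : 0)
  and can serve as an additional test point.\<close>

lemma minus_2_not_root: "- 2 \<notin> roots"
proof
  assume "- 2 \<in> roots"
  then have "norm ((- 2 :: complex) ^ n) = 1"
    by (simp add: roots_def)
  then have "(2::real) ^ n = 1"
    by (simp add: norm_power)
  then show False
    using one_less_power[of "2::real" n] n_ge_3 by simp
qed

text \<open>Two vertices and n further points give m = n + 2 zeros, enough for degree below m; in
  degree m the test point (1, 2) supplies the missing one. The lemma serves the sides z = 0 and y =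
  0.\<close>

lemma side_form_eq_0:
  fixes A :: "nat \<Rightarrow> complex"
  defines "g \<equiv> \<lambda>j x y. \<Sum>b\<le>j. A b * x ^ (j - b) * y ^ b"
  assumes j: "j \<le> m" and zero: "g j 1 0 = 0" "g j 0 1 = 0" "\<And>\<zeta>. \<zeta> \<in> roots \<Longrightarrow> g j 1 (- \<zeta>) = 0"
    and extra: "j = m \<Longrightarrow> g j 1 2 = 0" and b: "b \<le> j"
  shows "A b = 0"
proof -
  have inj: "inj_on (\<lambda>\<zeta>. (1 :: complex, - \<zeta>)) roots"
    by (auto intro: inj_onI)
  define S :: "(complex \<times> complex) set" where "S = {(1, 0), (0, 1)} \<union> (\<lambda>\<zeta>. (1, - \<zeta>)) ` roots"
  define S' where "S' = (if j = m then insert (1, 2) S else S)"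
  have finS: "finite S"
    by (simp add: S_def finite_roots)
  have "card S = m"
    unfolding S_def m_eq using finite_roots root_nonzero
    by (subst card_Un_disjoint) (auto simp: card_image[OF inj] card_roots)
  moreover have "(1, 2) \<notin> S"
    using minus_2_not_root by (auto simp: S_def)
  ultimately have cardS': "j < card S'"
    using j finS by (auto simp: S'_def)
  show ?thesis
  proof (rule binary_form_eq_0[OF _ cardS' _ _ _ b])
    show "finite S'"
      using finS by (simp add: S'_def)
    show "(\<Sum>b\<le>j. A b * x ^ (j - b) * y ^ b) = 0" if "(x, y) \<in> S'" for x y
      using that zero extra unfolding g_def by (auto simp: S'_def S_def split: if_splits)
    show "(0, 0) \<notin> S'"
      by (auto simp: S'_def S_def)
    show "x * y' \<noteq> x' * y" if "(x, y) \<in> S'" "(x', y') \<in> S'" "(x, y) \<noteq> (x', y')" for x y x' y'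
      using that minus_2_not_root root_nonzero by (auto simp: S'_def S_def split: if_splits)
  qed
qed

lemma fat_section_eq_0:
  assumes av: "avoids p q" and j: "1 \<le> j" "j \<le> m" and F: "homogeneous j F"
    and zero: "\<And>u. u \<in> normals \<Longrightarrow> eval3 F u = 0"
    and van: "\<And>a b. a + b < j - 1 \<Longrightarrow>
      eval3 ((deriv_X ^^ a) ((deriv_Y ^^ b) F)) (vector [p, q, 1]) = 0"
    and extra: "j = m \<Longrightarrow> eval3 F (vector [1, 2, 0]) = 0"
  shows "F = 0"
proof -
  define A where "A b = coeff3 (j - b) b 0 (shear p q F)" for b
  define B where "B b = coeff3 (j - 1 - b) b 1 (shear p q F)" for b
  have eval: "eval3 F (vector [x, y, z]) = (\<Sum>b\<le>j. A b * (x - p * z) ^ (j - b) * (y - q * z) ^ b)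
      + z * (\<Sum>b\<le>j - 1. B b * (x - p * z) ^ (j - 1 - b) * (y - q * z) ^ b)" for x y z
    using eval3_large_multiplicity[OF F j(1) van, of "vector [x, y, z]"] by (simp add: A_def B_def)
  have "A b = 0" if "b \<le> j" for b
  proof (rule side_form_eq_0[OF j(2) _ _ _ _ that])
    have on_side: "(\<Sum>b\<le>j. A b * x ^ (j - b) * y ^ b) = eval3 F (vector [x, y, 0])" for x y
      by (simp add: eval)
    show "(\<Sum>b\<le>j. A b * 1 ^ (j - b) * 0 ^ b) = 0" "(\<Sum>b\<le>j. A b * 0 ^ (j - b) * 1 ^ b) = 0"
      unfolding on_side by (rule zero, simp add: normals_def)+
    show "(\<Sum>b\<le>j. A b * 1 ^ (j - b) * (- \<zeta>) ^ b) = 0" if "\<zeta> \<in> roots" for \<zeta>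
      unfolding on_side by (rule zero) (use that in \<open>simp add: normals_def\<close>)
    show "(\<Sum>b\<le>j. A b * 1 ^ (j - b) * 2 ^ b) = 0" if "j = m"
      unfolding on_side by (rule extra[OF that])
  qed
  then have eval: "eval3 F (vector [x, y, z])
      = z * (\<Sum>b\<le>j - 1. B b * (x - p * z) ^ (j - 1 - b) * (y - q * z) ^ b)" for x y z
    by (simp add: eval)
  have w1: "w 1 \<in> roots"
    using w_root k by simp
  have p: "p \<noteq> 0" and q: "q \<noteq> 0"
    using avoidsD[OF av, of 1 0 0] avoidsD[OF av, of 0 1 0] one_root by auto
  \<comment> \<open>These are the vectors (x - pz, y - qz) for the points (0 : 0 : 1), (0 :
    -\<open>w 1\<close> : 1) and (1 : 0 : -\<zeta>), that is, their projections from (p : q :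
    1).\<close>
  define T where "T = {(- p, - q), (- p, - w 1 - q)} \<union> (\<lambda>\<zeta>. (1 + p * \<zeta>, q * \<zeta>)) ` roots"
  \<comment> \<open>The determinants are nonzero because the line joining the two points misses (p :
    q : 1). For \<open>det1\<close> this line has coefficients (\<zeta> \<open>w 1\<close>, 1,
    \<open>w 1\<close>); in the other cases it is a side of the coordinate triangle.\<close>
  have det1: "(1 + p * \<zeta>) * (- w 1 - q) \<noteq> - p * (q * \<zeta>)" if "\<zeta> \<in> roots" for \<zeta>
  proof -
    have "\<zeta> * w 1 * p + 1 * q + w 1 \<noteq> 0"
      using that w1 root_mult one_root by (intro avoidsD[OF av]) auto
    moreover have "(1 + p * \<zeta>) * (- w 1 - q) - - p * (q * \<zeta>) = - (\<zeta> * w 1 * p + 1 * q + w 1)"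
      by (simp add: algebra_simps)
    ultimately show ?thesis
      by (metis right_minus_eq neg_equal_0_iff_equal)
  qed
  have det2: "(1 + p * \<zeta>) * (- q) \<noteq> - p * (q * \<zeta>)" for \<zeta>
    using q by (simp add: algebra_simps)
  have inj2: "inj_on (\<lambda>\<zeta>. (1 + p * \<zeta>, q * \<zeta>)) roots"
    using q by (auto intro: inj_onI)
  have det3: "(1 + p * \<zeta>) * (q * \<eta>) \<noteq> (1 + p * \<eta>) * (q * \<zeta>)" if "\<zeta> \<noteq> \<eta>" for \<zeta> \<eta>
    using q that by (simp add: algebra_simps)
  have w1_nz: "w 1 \<noteq> 0"
    using w1 by (rule root_nonzero)
  have det0: "- p * (- w 1 - q) \<noteq> - p * (- q)"
    using p w1_nz by (simp add: algebra_simps)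
  have "{(- p, - q), (- p, - w 1 - q)} \<inter> (\<lambda>\<zeta>. (1 + p * \<zeta>, q * \<zeta>)) ` roots = {}"
  proof -
    have "(1 + p * \<zeta>, q * \<zeta>) \<notin> {(- p, - q), (- p, - w 1 - q)}" if "\<zeta> \<in> roots" for \<zeta>
    proof
      assume "(1 + p * \<zeta>, q * \<zeta>) \<in> {(- p, - q), (- p, - w 1 - q)}"
      then have "1 + p * \<zeta> = - p" "q * \<zeta> = - q \<or> q * \<zeta> = - w 1 - q"
        by auto
      then show False
        using det1[OF that] det2[of \<zeta>] by metis
    qed
    then show ?thesis
      unfolding disjoint_iff by (metis (no_types, lifting) imageE)
  qed
  moreover have "card {(- p, - q), (- p, - w 1 - q)} = 2"
    using w1_nz by auto
  ultimately have "card T = m"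
    unfolding T_def m_eq using finite_roots
    by (subst card_Un_disjoint) (auto simp: card_image[OF inj2] card_roots)
  then have cardT: "j - 1 < card T"
    using j by simp
  have "B b = 0" if "b \<le> j - 1" for b
  proof (rule binary_form_eq_0[OF _ cardT _ _ _ that])
    show "finite T"
      by (simp add: T_def finite_roots)
    have *: "(\<Sum>b\<le>j - 1. B b * (x - p * z) ^ (j - 1 - b) * (y - q * z) ^ b) = 0"
      if "vector [x, y, z] \<in> normals" "z \<noteq> 0" for x y z
      using zero[OF that(1)] that(2) by (simp add: eval)
    show "(\<Sum>b\<le>j - 1. B b * x ^ (j - 1 - b) * y ^ b) = 0" if xy: "(x, y) \<in> T" for x y
    proof -
      consider "(x, y) = (- p, - q)" | "(x, y) = (- p, - w 1 - q)"
        | \<zeta> where "\<zeta> \<in> roots" "(x, y) = (1 + p * \<zeta>, q * \<zeta>)"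
        using xy by (auto simp: T_def)
      then show ?thesis
      proof cases
        case 1
        then show ?thesis
          using *[of 0 0 1] by (simp add: normals_def)
      next
        case 2
        then show ?thesis
          using *[of 0 "- w 1" 1] k by (simp add: normals_def)
      next
        case 3
        then show ?thesis
          using *[of 1 0 "- \<zeta>"] root_nonzero by (simp add: normals_def)
      qed
    qed
    show "(0, 0) \<notin> T"
      using p q root_nonzero by (auto simp: T_def)
    show "x * y' \<noteq> x' * y" if "(x, y) \<in> T" "(x', y') \<in> T" "(x, y) \<noteq> (x', y')" for x y x' y'
      using that unfolding T_def
      by (elim UnE insertE imageE emptyE) (metis Pair_inject det0 det1 det2 det3)+
  qed
  then have "eval3 F (vector [x, y, z]) = 0" for x y z
    by (simp add: eval)
  then have "eval3 F v = 0" for v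
    using forall_vector_3[of "\<lambda>v. eval3 F v = 0"] by blast
  then show ?thesis
    by (rule eval3_eq_0)
qed

lemma sections_fat_eq_0:
  assumes "avoids p q" "1 \<le> j" "j \<le> m"
    and F: "F \<in> sections_fat j (Z_points m k w) (j - 1) (proj (vector [p, q, 1]))"
    and "j = m \<Longrightarrow> eval3 F (vector [1, 2, 0]) = 0"
  shows "F = 0"
proof (rule fat_section_eq_0)
  have F': "F \<in> sections j (Z_points m k w)"
    "vanishes_to_order (j - 1) F (proj (vector [p, q, 1]))"
    using F by (simp_all add: sections_fat_def)
  show "homogeneous j F" "\<And>u. u \<in> normals \<Longrightarrow> eval3 F u = 0"
    using F'(1) by (simp_all add: sections_iff)
  have "(vector [p, q, 1] :: complex ^ 3) \<noteq> 0"
    by (auto simp: vec_eq_iff forall_3)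
  then have "vector [p, q, 1] \<in> coords (proj (vector [p, q, 1]))"
    by (rule self_in_coords_proj)
  then show "eval3 ((deriv_X ^^ a) ((deriv_Y ^^ b) F)) (vector [p, q, 1]) = 0"
    if "a + b < j - 1" for a b
    using F'(2)[unfolded vanishes_to_order_def, rule_format, of a b 0] that by simp
qed (use assms in auto)

section \<open>The curve of degree m\<close>

text \<open>The equation is \<open>v \<cdot> \<theta>(v \<times> Q) = 0\<close> with \<open>Q = (p, q, 1)\<close> and
  \<open>\<theta>(x, y, z) = (x\<^bsup>n+1\<^esup>, y\<^bsup>n+1\<^esup>, z\<^bsup>n+1\<^esup>)\<close>.\<close>

definition curve :: "complex \<Rightarrow> complex \<Rightarrow> cpoly3" where
  "curve p q = X * (Y - const3 q * Z) ^ (n + 1) + Y * (const3 p * Z - X) ^ (n + 1)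
     + Z * (const3 q * X - const3 p * Y) ^ (n + 1)"

lemma m_minus_1: "m - 1 = n + 1"
  by (simp add: m_eq)

lemma homogeneous_curve: "homogeneous m (curve p q)"
  unfolding homogeneous_iff_eval3
proof (intro allI)
  fix c and v :: "complex ^ 3"
  have "c * v$2 - q * (c * v$3) = c * (v$2 - q * v$3)" "p * (c * v$3) - c * v$1 = c * (p * v$3 - v$1)"
    "q * (c * v$1) - p * (c * v$2) = c * (q * v$1 - p * v$2)"
    by (simp_all add: algebra_simps)
  then show "eval3 (curve p q) (c *s v) = c ^ m * eval3 (curve p q) v"
    by (simp add: curve_def m_eq power_mult_distrib) (simp add: algebra_simps)
qed

text \<open>The vector u \<times> Q lies on the line with normal u, and \<theta> is tangent to that
  line, so u \<cdot> \<theta>(u \<times> Q) = 0. The proof verifies this for each family of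
  normals.\<close>

lemma curve_normals:
  assumes "u \<in> normals"
  shows "eval3 (curve p q) u = 0"
proof -
  have neg: "(- \<zeta>) ^ n = (- 1) ^ n" if "\<zeta> \<in> roots" for \<zeta>
    using that power_minus[of \<zeta> n] by (simp add: roots_def)
  show ?thesis
    using assms w_root unfolding normals_def
    by (auto simp: curve_def neg power_mult_distrib) (auto simp: roots_def)
qed

text \<open>Each summand contains the power n + 1 = m - 1 of an entry of v \<times> Q, and all three
  entries vanish at v = Q.\<close>

lemma curve_in_sections_fat:
  "curve p q \<in> sections_fat m (Z_points m k w) (m - 1) (proj (vector [p, q, 1]))"
proof -
  have "in_ideal_power v (m - 1) (curve p q)" if v: "v \<in> coords (proj (vector [p, q, 1]))" for v
  proof -
    have "(vector [p, q, 1] :: complex ^ 3) \<noteq> 0"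
      by (auto simp: vec_eq_iff forall_3)
    then obtain c where c: "v = c *s vector [p, q, 1]"
      using v by (auto simp: coords_proj)
    show ?thesis
      unfolding m_minus_1 curve_def
      by (intro in_ideal_power.add in_ideal_power_power) (simp_all add: c)
  qed
  then show ?thesis
    by (simp add: sections_fat_def sections_iff homogeneous_curve curve_normals vanishes_to_orderI)
qed

text \<open>The value is twice \<open>2 ^ n - (- 1) ^ n\<close>, and the two powers have different
  norms.\<close>

lemma curve_at_extra_point: "eval3 (curve p q) (vector [1, 2, 0]) \<noteq> 0"
proof
  assume "eval3 (curve p q) (vector [1, 2, 0]) = 0"
  then have "(2::complex) ^ n = (- 1) ^ n"
    by (simp add: curve_def)
  then have "norm ((2::complex) ^ n) = norm ((- 1 :: complex) ^ n)"
    by simp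
  then have "(2::real) ^ n = 1"
    by (simp add: norm_power)
  then show False
    using one_less_power[of "2::real" n] n_ge_3 by simp
qed

text \<open>Subtracting the multiple of the curve with the same value at (1 : 2 : 0) leaves a
  section that also vanishes there, hence 0.\<close>

lemma curve_unique:
  assumes "avoids p q" "F \<in> sections_fat m (Z_points m k w) (m - 1) (proj (vector [p, q, 1]))"
  shows "\<exists>c. F = const3 c * curve p q"
proof -
  let ?v = "vector [1, 2, 0] :: complex ^ 3"
  let ?c = "eval3 F ?v / eval3 (curve p q) ?v"
  have "F - scale3 ?c (curve p q) = 0"
  proof (rule sections_fat_eq_0[OF assms(1)])
    show "F - scale3 ?c (curve p q) \<in> sections_fat m (Z_points m k w) (m - 1) (proj (vector [p, q, 1]))"
      using assms(2) curve_in_sections_fat subspace_sections_fat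
      by (intro cpoly3.subspace_diff cpoly3.subspace_scale) auto
    show "eval3 (F - scale3 ?c (curve p q)) ?v = 0"
      using curve_at_extra_point by (simp add: scale3_def)
  qed (use m in auto)
  then show ?thesis
    by (auto simp: scale3_def)
qed

section \<open>Irreducibility of the curve\<close>

text \<open>At a common zero of the two coefficients, the line with coefficients \<open>(y, - x, q x - p y)\<close>
  passes through \<open>(p, q, 1)\<close> and its coefficients are \<open>0\<close> or have equal \<open>n\<close>-th powers.\<close>

lemma curve_no_common_zero:
  assumes av: "avoids p q"
    and A: "x * y ^ (n + 1) + y * (- x) ^ (n + 1) = 0"
    and B: "p * y ^ (n + 1) + q * (- x) ^ (n + 1) + (q * x - p * y) ^ (n + 1) = 0"
  shows "(x, y) = (0, 0)"
proof (rule ccontr)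
  assume nz: "(x, y) \<noteq> (0, 0)"
  \<comment> \<open>The vector (y, a, b) is the cross product of (x, y, 0) and (p, q, 1), hence
    orthogonal to (p, q, 1). In these terms the two equations compare n-th powers of its
    entries.\<close>
  define a where "a = - x"
  define b where "b = q * x - p * y"
  have sum0: "p * y + q * a + b = 0"
    by (simp add: a_def b_def)
  have pq: "p \<noteq> 0" "q \<noteq> 0"
    using avoidsD[OF av, of 1 0 0] avoidsD[OF av, of 0 1 0] one_root by auto
  have A': "a * y * (a ^ n - y ^ n) = 0"
    using A by (simp add: a_def algebra_simps)
  have B': "p * y * y ^ n + q * a * a ^ n + b * b ^ n = 0"
    using B by (simp add: a_def b_def mult.assoc)
  consider "y = 0" "a \<noteq> 0" | "a = 0" "y \<noteq> 0" | "y \<noteq> 0" "a ^ n = y ^ n"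
    using A' nz by (auto simp: a_def)
  then show False
  proof cases
    case 1
    then have b: "b = - q * a"
      using sum0 by (simp add: algebra_simps eq_neg_iff_add_eq_0)
    then have "q * a * (a ^ n - b ^ n) = 0"
      using B' 1 n_ge_3 by (simp add: algebra_simps)
    then have "b ^ n = a ^ n"
      using 1 pq by simp
    then obtain \<zeta> where \<zeta>: "\<zeta> \<in> roots" "b = \<zeta> * a"
      unfolding power_eq_iff_root by blast
    then have "(q + \<zeta>) * a = 0"
      using sum0 1 by (simp add: algebra_simps)
    then show False
      using avoidsD[OF av, of 0 1 \<zeta>] \<zeta>(1) one_root 1 by simp
  next
    case 2
    then have b: "b = - p * y"
      using sum0 by (simp add: algebra_simps eq_neg_iff_add_eq_0)
    then have "p * y * (y ^ n - b ^ n) = 0"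
      using B' 2 n_ge_3 by (simp add: algebra_simps)
    then have "b ^ n = y ^ n"
      using 2 pq by simp
    then obtain \<zeta> where \<zeta>: "\<zeta> \<in> roots" "b = \<zeta> * y"
      unfolding power_eq_iff_root by blast
    then have "(p + \<zeta>) * y = 0"
      using sum0 2 by (simp add: algebra_simps)
    then show False
      using avoidsD[OF av, of 1 0 \<zeta>] \<zeta>(1) one_root 2 by simp
  next
    case 3
    then obtain \<zeta> where \<zeta>: "\<zeta> \<in> roots" "a = \<zeta> * y"
      unfolding power_eq_iff_root by blast
    have "p * y + q * a = - b"
      using sum0 by (simp add: eq_neg_iff_add_eq_0)
    then have "p * y * y ^ n + q * a * a ^ n = - b * y ^ n"
      using 3(2) by (metis distrib_right)
    then have "b * (b ^ n - y ^ n) = 0"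
      using B' by (simp add: algebra_simps)
    then consider "b = 0" | "b ^ n = y ^ n"
      by auto
    then obtain \<eta> where \<eta>: "\<eta> = 0 \<or> \<eta> \<in> roots" "b = \<eta> * y"
      unfolding power_eq_iff_root by cases auto
    have "(p + \<zeta> * q + \<eta>) * y = 0"
      using sum0 \<zeta>(2) \<eta>(2) by (simp add: algebra_simps)
    then show False
      using avoidsD[OF av, of 1 \<zeta> \<eta>] \<zeta>(1) \<eta>(1) one_root 3(1) by simp
  qed
qed

lemma irreducible_curve:
  assumes av: "avoids p q"
  shows "irreducible (curve p q)"
proof (rule irreducible_shear)
  define x y :: "complex poly poly" where "x = [:[:0, 1:]:]" and "y = [:0, 1:]"
  define A where "A = x * y ^ (n + 1) + y * (- x) ^ (n + 1)"
  define B where "B = [:[:p:]:] * y ^ (n + 1) + [:[:q:]:] * (- x) ^ (n + 1)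
    + ([:[:q:]:] * x - [:[:p:]:] * y) ^ (n + 1)"
  have XY: "X = [:x:]" "Y = [:y:]" "const3 c = [:[:[:c:]:]:]" for c
    by (simp_all add: X_def Y_def x_def y_def const3_def)
  \<comment> \<open>The shear turns Y - qZ into Y and pZ - X into -X, and it fixes qX - pY. So
    \<open>Z\<close> remains only to the first power.\<close>
  have "shear p q (curve p q) = (X + const3 p * Z) * Y ^ (n + 1) + (Y + const3 q * Z) * (- X) ^ (n + 1)
      + Z * (const3 q * X - const3 p * Y) ^ (n + 1)"
    by (simp add: curve_def shear_simps shear_diff shear_power algebra_simps)
  also have "\<dots> = (X * Y ^ (n + 1) + Y * (- X) ^ (n + 1))
      + Z * (const3 p * Y ^ (n + 1) + const3 q * (- X) ^ (n + 1) + (const3 q * X - const3 p * Y) ^ (n + 1))"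
    by (simp only: algebra_simps)
  also have "X * Y ^ (n + 1) + Y * (- X) ^ (n + 1) = [:A:]"
    unfolding XY A_def poly_const_pow by (simp add: poly_const_pow)
  also have "const3 p * Y ^ (n + 1) + const3 q * (- X) ^ (n + 1) + (const3 q * X - const3 p * Y) ^ (n + 1) = [:B:]"
    unfolding XY B_def by (simp add: poly_const_pow mult_ac)
  also have "[:A:] + Z * [:B:] = [:A, B:]"
    by (simp add: Z_def)
  finally have eq: "shear p q (curve p q) = [:A, B:]" .
  have no_zero: "(s, t) = (0, 0)" if "poly (poly A [:t:]) s = 0" "poly (poly B [:t:]) s = 0" for s t
  proof (rule curve_no_common_zero[OF av])
    show "s * t ^ (n + 1) + t * (- s) ^ (n + 1) = 0"
      using that(1) by (simp add: A_def x_def y_def poly_power)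
    show "p * t ^ (n + 1) + q * (- s) ^ (n + 1) + (q * s - p * t) ^ (n + 1) = 0"
      using that(2) by (simp add: B_def x_def y_def poly_power algebra_simps)
  qed
  \<comment> \<open>\<open>A\<close> vanishes at (1, 0), so \<open>B = 0\<close> would make this a
    forbidden common zero.\<close>
  have "B \<noteq> 0"
    using no_zero[of 1 0] by (auto simp: A_def x_def y_def poly_power)
  then show "irreducible (shear p q (curve p q))"
    unfolding eq using no_zero by (rule irreducible_linear)
qed

section \<open>Dimension counts\<close>

text \<open>A section of degree \<open>m\<close> is determined by its \<open>(m - 1) choose 2\<close> coefficients away from the
  coordinate triangle, by one value on each of two sides and by \<open>m - 3\<close> values on the third.\<close>

lemma
  shows h0_sections_le: "h0 (sections m (Z_points m k w)) \<le> m choose 2"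
    and h0_sections_fat_pos: "0 < h0 (sections_fat m (Z_points m k w) (m - 1) (proj (vector [p, q, 1])))"
proof -
  let ?S = "sections m (Z_points m k w)"
  let ?T = "{(a, b). 1 \<le> a \<and> 1 \<le> b \<and> a + b \<le> m - 1}"
  have "infinite (UNIV - {0, - w 1, - w 2})"
    by (simp add: infinite_UNIV_char_0)
  \<comment> \<open>The side x = 0 is known to contain (0 : 1 : 0), (0 : 0 : 1) and the points for
    \<open>w 1\<close> and \<open>w 2\<close>. With m - 3 further values this makes m + 1
    zeros.\<close>
  then obtain V :: "complex set" where V: "finite V" "card V = m - 3" "V \<subseteq> UNIV - {0, - w 1, - w 2}"
    using infinite_arbitrarily_large by metis
  define P :: "(complex ^ 3) set" where
    "P = {vector [1, 2, 0], vector [1, 0, 2]} \<union> (\<lambda>y. vector [0, y, 1]) ` V"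
  define I where "I = Inl ` ?T \<union> Inr ` P"
  define f where "f i F = (case i of Inl (a, b) \<Rightarrow> coeff3 a b (m - a - b) F | Inr v \<Rightarrow> eval3 F v)" for i F
  have finI: "finite I"
    unfolding I_def P_def using V(1) card_interior(1) by blast
  have "card I \<le> card ?T + card P"
    unfolding I_def by (rule order_trans[OF card_Un_le add_mono[OF card_image_le card_image_le]])
      (use card_interior(1) V(1) in \<open>simp_all add: P_def\<close>)
  also have "card P \<le> 2 + (m - 3)"
    unfolding P_def using V
    by (intro order_trans[OF card_Un_le] add_mono card_insert_le_m1 order_trans[OF card_image_le]) auto
  \<comment> \<open>Here (m - 1 choose 2) + (m - 1) = (m choose 2).\<close>
  also have "card ?T + (2 + (m - 3)) = m choose 2"
    unfolding card_interior(2) using m by (cases m) (simp_all add: numeral_2_eq_2)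
  finally have cardI: "card I \<le> m choose 2"
    by simp
  have add: "f i (F + G) = f i F + f i G" for i F G
    by (auto simp: f_def split: sum.splits)
  have scale: "f i (scale3 c F) = c * f i F" for i c F
    by (auto simp: f_def scale3_def coeff3_const_mult split: sum.splits)
  have sep: "F = 0" if F: "F \<in> ?S" and f0: "\<And>i. i \<in> I \<Longrightarrow> f i F = 0" for F
  proof (rule cpoly3_eqI)
    have hom: "homogeneous m F" and zero: "\<And>u. u \<in> normals \<Longrightarrow> eval3 F u = 0"
      using F by (simp_all add: sections_iff)
    have interior: "coeff3 a b c F = 0" if "a \<ge> 1" "b \<ge> 1" "c \<ge> 1" "a + b + c = m" for a b c
    proof -
      have "f (Inl (a, b)) F = 0" "c = m - a - b"
        using that by (auto intro!: f0 simp: I_def)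
      then show ?thesis
        by (simp add: f_def)
    qed
    have point: "eval3 F v = 0" if "v \<in> P" for v
      using f0[of "Inr v"] that by (simp add: f_def I_def)
    have side_z: "coeff3 (m - b) b 0 F = 0" if "b \<le> m" for b
    proof (rule side_form_eq_0[OF order_refl _ _ _ _ that])
      show "(\<Sum>b\<le>m. coeff3 (m - b) b 0 F * 1 ^ (m - b) * 2 ^ b) = 0"
        unfolding eval3_side[OF hom, symmetric] by (rule point) (simp add: P_def)
    qed (unfold eval3_side[OF hom, symmetric], (rule zero, simp add: normals_def)+)
    have side_y: "coeff3 (m - c) 0 c F = 0" if "c \<le> m" for c
    proof (rule side_form_eq_0[OF order_refl _ _ _ _ that])
      show "(\<Sum>c\<le>m. coeff3 (m - c) 0 c F * 1 ^ (m - c) * 2 ^ c) = 0"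
        unfolding eval3_side[OF hom, symmetric] by (rule point) (simp add: P_def)
    qed (unfold eval3_side[OF hom, symmetric], (rule zero, simp add: normals_def)+)
    have side_x: "coeff3 0 (m - c) c F = 0" if "c \<le> m" for c
    proof -
      define W where "W = {0, - w 1, - w 2} \<union> V"
      define S where "S = insert (1, 0) ((\<lambda>y. (y, 1 :: complex)) ` W)"
      have "w 1 \<noteq> w 2"
        using inj_w k by (auto dest: inj_onD)
      moreover have "w 1 \<noteq> 0" "w 2 \<noteq> 0"
        using k by (auto intro!: root_nonzero w_root)
      ultimately have "card W = m"
        unfolding W_def using V m by (subst card_Un_disjoint) auto
      moreover have "finite W"
        using V by (simp add: W_def)
      moreover have "card ((\<lambda>y. (y, 1 :: complex)) ` W) = card W"
        by (rule card_image) (auto intro: inj_onI)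
      ultimately have cardS: "m < card S" and finS: "finite S"
        unfolding S_def by (auto simp: card_insert_if)
      have zero': "eval3 F (vector [0, y, z]) = 0" if yz: "(y, z) \<in> S" for y z
      proof -
        consider "y = 1" "z = 0" | "y = 0" "z = 1" | "y = - w 1" "z = 1" | "y = - w 2" "z = 1"
          | "y \<in> V" "z = 1"
          using yz by (auto simp: S_def W_def)
        then show ?thesis
        proof cases
          case 5
          then show ?thesis
            by (intro point) (simp add: P_def)
        qed (use k in \<open>simp_all add: zero normals_def\<close>)
      qed
      show ?thesis
      proof (rule binary_form_eq_0[OF finS cardS _ _ _ that])
        show "(\<Sum>c\<le>m. coeff3 0 (m - c) c F * y ^ (m - c) * z ^ c) = 0" if "(y, z) \<in> S" for y z
          unfolding eval3_side[OF hom, symmetric] using that by (rule zero')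
      qed (auto simp: S_def)
    qed
    show "coeff3 a b c F = coeff3 a b c 0" for a b c
    proof (cases "a + b + c = m")
      case True
      then consider "c = 0" "a = m - b" "b \<le> m" | "b = 0" "a = m - c" "c \<le> m"
        | "a = 0" "b = m - c" "c \<le> m" | "a \<ge> 1" "b \<ge> 1" "c \<ge> 1"
        by linarith
      then show ?thesis
        using interior[OF _ _ _ True] side_x[of c] side_y[of c] side_z[of b] by cases auto
    qed (simp add: homogeneous_coeff3[OF hom])
  qed
  show "h0 ?S \<le> m choose 2"
    unfolding h0_def
    using dim_le_card_functionals[where f = f, OF finI subspace_sections add scale sep] cardI
    by (rule order_trans)
  show "0 < h0 (sections_fat m (Z_points m k w) (m - 1) (proj (vector [p, q, 1])))"
    unfolding h0_def
  \<comment> \<open>The same functionals separate the smaller space, which is therefore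
    finite-dimensional; the curve is a nonzero element.\<close>
  proof (rule dim_pos[where f = f, OF finI subspace_sections_fat add scale])
    show "F = 0" if "F \<in> sections_fat m (Z_points m k w) (m - 1) (proj (vector [p, q, 1]))"
      "\<And>i. i \<in> I \<Longrightarrow> f i F = 0" for F
      using that by (intro sep) (simp_all add: sections_fat_def)
    show "curve p q \<noteq> 0"
      using curve_at_extra_point[of p q] by auto
  qed (rule curve_in_sections_fat)
qed

section \<open>Unexpectedness, minimality and irreducibility\<close>

lemma h0_sections_fat_eq_0:
  assumes "avoids p q" "1 \<le> j" "j < m"
  shows "h0 (sections_fat j (Z_points m k w) (j - 1) (proj (vector [p, q, 1]))) = 0"
proof -
  have "sections_fat j (Z_points m k w) (j - 1) (proj (vector [p, q, 1])) \<subseteq> cpoly3.span {}"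
    using sections_fat_eq_0[OF assms(1,2)] assms(3) by auto
  then show ?thesis
    unfolding h0_def using cpoly3.dim_le_card[of _ "{}"] by simp
qed

text \<open>Since the sections have dimension at most \<open>m choose 2\<close>, the expected
  dimension is 0 and the existence of the curve suffices.\<close>

lemma admits_unexpected_curves_m: "admits_unexpected_curves (Z_points m k w) m"
  unfolding admits_unexpected_curves_def
proof (intro conjI)
  show "finite (Z_points m k w)"
    by (simp add: Z_points_eq finite_normals)
  show "generically (\<lambda>q. int (h0 (sections_fat m (Z_points m k w) (m - 1) q))
      > max 0 (int (h0 (sections m (Z_points m k w))) - int (m choose 2)))"
    using generically_avoids
  proof (rule generically_mono)
    fix Q assume "\<exists>p q. Q = proj (vector [p, q, 1]) \<and> avoids p q"
    then obtain p q where "Q = proj (vector [p, q, 1])"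
      by blast
    then show "int (h0 (sections_fat m (Z_points m k w) (m - 1) Q))
      > max 0 (int (h0 (sections m (Z_points m k w))) - int (m choose 2))"
      using h0_sections_fat_pos[of p q] h0_sections_le by simp
  qed
qed (use m in simp)

text \<open>Two generic conditions share a point. There a smaller degree would require a nonzero
  section and also exclude it.\<close>

lemma unexpected_degree_ge:
  assumes "admits_unexpected_curves (Z_points m k w) j"
  shows "m \<le> j"
proof (rule ccontr)
  assume "\<not> m \<le> j"
  moreover have "j \<ge> 2"
    using assms by (simp add: admits_unexpected_curves_def)
  moreover obtain Q p q where "Q = proj (vector [p, q, 1])" "avoids p q"
    "h0 (sections_fat j (Z_points m k w) (j - 1) Q) > 0"
    using generically_meet[OF generically_avoids] assms unfolding admits_unexpected_curves_def
    by fastforce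
  ultimately show False
    using h0_sections_fat_eq_0[of p q j] by simp
qed

text \<open>By uniqueness every such form is a nonzero constant, hence a unit, times the irreducible
  curve.\<close>

lemma generically_irreducible:
  "generically (\<lambda>q. \<forall>F. unexpected_curve (Z_points m k w) m q F \<longrightarrow> irreducible F)"
  using generically_avoids
proof (rule generically_mono, intro allI impI)
  fix Q F
  assume "\<exists>p q. Q = proj (vector [p, q, 1]) \<and> avoids p q"
  then obtain p q where Q: "Q = proj (vector [p, q, 1])" and av: "avoids p q"
    by blast
  assume "unexpected_curve (Z_points m k w) m Q F"
  then have "F \<noteq> 0" "F \<in> sections_fat m (Z_points m k w) (m - 1) Q"
    by (simp_all add: unexpected_curve_def)
  then obtain c where c: "F = const3 c * curve p q"
    using curve_unique[OF av] Q by blast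
  then have "c \<noteq> 0"
    using \<open>F \<noteq> 0\<close> by auto
  then show "irreducible F"
    unfolding c using irreducible_curve[OF av] const3_unit irreducible_mult_unit_left by blast
qed

end

theorem proposition3p5:
  fixes m k n :: nat and w :: "nat \<Rightarrow> complex"
  assumes "m \<ge> 5" and "2 \<le> k" and "k \<le> m - 3" and "n = m - 2"
    and "\<forall>i\<in>{1..k}. w i ^ n = 1"
    and "inj_on w {1..k}"
  shows "admits_unexpected_curves (Z_points m k w) m
       \<and> (\<forall>j. admits_unexpected_curves (Z_points m k w) j \<longrightarrow> m \<le> j)
       \<and> generically (\<lambda>q. \<forall>F. unexpected_curve (Z_points m k w) m q F \<longrightarrow> irreducible F)"
proof -
  interpret monomial_arrangement m k n w
    using assms by unfold_locales auto
  show ?thesis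
    using admits_unexpected_curves_m unexpected_degree_ge generically_irreducible by blast
qed

end
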